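(* Let $\mathcal{A}$ be an additive category and $N\in\mathbb{N}$. Then $\mathcal{S}_\oplus$ defines a Frobenius exact structure on the category $\mathrm{C}_N(\mathcal{A})$ of $N$-complexes in $\mathcal{A}$.
   Context: An $N$-complex in $\mathcal{A}$ is a $\mathbb{Z}$-indexed diagram $\cdots\to X^{n-1}\xrightarrow{d_X}X^n\xrightarrow{d_X}X^{n+1}\to\cdots$ with $d_X^N=0$; morphisms are families $g^i:X^i\to Y^i$ commuting with the differentials. They form $\mathrm{C}_N(\mathcal{A})$. $\mathcal{S}_\oplus$ is the collection of all levelwise split short exact sequences in $\mathrm{C}_N(\mathcal{A})$, i.e. sequences $X\to Y\to Z$ of $N$-complexes which in each degree are isomorphic to a sequence of the form $0\to A\xrightarrow{\begin{bmatrix}\mathrm{Id}\\0\end{bmatrix}}A\oplus B\xrightarrow{\begin{bmatrix}0&\mathrm{Id}\end{bmatrix}}B\to0$. A Frobenius exact structure on an additive category is an exact structure $\mathcal{S}$ (in the sense of Quillen) such that there are enough $\mathcal{S}$-projective and enough $\mathcal{S}$-injective objects and the $\mathcal{S}$-projective objects are precisely the $\mathcal{S}$-injective objects. *)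

theory Defs
  imports "HOL-Algebra.Group"
begin

section \<open>Categories and additive categories\<close>

text \<open>
  A category has a set of objects, a set of morphisms for every pair of objects, identities and
  composition. Hom-sets need not be disjoint, so a morphism is always considered together with
  its source and target; one composition operation (and below one addition) serves all hom-sets.
  A category whose morphisms determine source and target is the special case of disjoint hom-sets.
\<close>

record ('o, 'm) category =
  Obj :: "'o set"
  Hom :: "'o \<Rightarrow> 'o \<Rightarrow> 'm set"
  Ide :: "'o \<Rightarrow> 'm"
  Comp :: "'m \<Rightarrow> 'm \<Rightarrow> 'm"  (infixr \<open>\<cdot>\<index>\<close> 70)

locale category =
  fixes C :: "('o, 'm, 'e) category_scheme" (structure)
  assumes hom_obj: "f \<in> Hom C X Y \<Longrightarrow> X \<in> Obj C \<and> Y \<in> Obj C"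
    and ide_hom: "X \<in> Obj C \<Longrightarrow> Ide C X \<in> Hom C X X"
    and comp_hom: "f \<in> Hom C X Y \<Longrightarrow> g \<in> Hom C Y Z \<Longrightarrow> g \<cdot> f \<in> Hom C X Z"
    and comp_ide_right: "f \<in> Hom C X Y \<Longrightarrow> f \<cdot> Ide C X = f"
    and comp_ide_left: "f \<in> Hom C X Y \<Longrightarrow> Ide C Y \<cdot> f = f"
    and comp_assoc: "f \<in> Hom C W X \<Longrightarrow> g \<in> Hom C X Y \<Longrightarrow> h \<in> Hom C Y Z \<Longrightarrow>
      (h \<cdot> g) \<cdot> f = h \<cdot> (g \<cdot> f)"

definition iso_arrow :: "('o, 'm, 'e) category_scheme \<Rightarrow> 'o \<Rightarrow> 'o \<Rightarrow> 'm \<Rightarrow> bool" where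
  "iso_arrow C X Y f \<longleftrightarrow> f \<in> Hom C X Y \<and>
     (\<exists>g \<in> Hom C Y X. g \<cdot>\<^bsub>C\<^esub> f = Ide C X \<and> f \<cdot>\<^bsub>C\<^esub> g = Ide C Y)"

definition zero_object :: "('o, 'm, 'e) category_scheme \<Rightarrow> 'o \<Rightarrow> bool" where
  "zero_object C Z \<longleftrightarrow> Z \<in> Obj C \<and>
     (\<forall>X \<in> Obj C. (\<exists>!f. f \<in> Hom C X Z) \<and> (\<exists>!f. f \<in> Hom C Z X))"

text \<open>
  The square \<open>f \<cdot> p' = p \<cdot> f'\<close> with \<open>p' : P \<rightarrow> Z'\<close>, \<open>f' : P \<rightarrow> Y\<close>, \<open>p : Y \<rightarrow> Z\<close>, \<open>f : Z' \<rightarrow> Z\<close>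
  is cartesian.
\<close>

definition is_pullback ::
  "('o, 'm, 'e) category_scheme \<Rightarrow> 'o \<Rightarrow> 'm \<Rightarrow> 'm \<Rightarrow> 'o \<Rightarrow> 'o \<Rightarrow> 'm \<Rightarrow> 'm \<Rightarrow> 'o \<Rightarrow> bool" where
  "is_pullback C P p' f' Z' Y p f Z \<longleftrightarrow>
     p' \<in> Hom C P Z' \<and> f' \<in> Hom C P Y \<and> p \<in> Hom C Y Z \<and> f \<in> Hom C Z' Z \<and>
     f \<cdot>\<^bsub>C\<^esub> p' = p \<cdot>\<^bsub>C\<^esub> f' \<and>
     (\<forall>T \<in> Obj C. \<forall>a \<in> Hom C T Z'. \<forall>b \<in> Hom C T Y. f \<cdot>\<^bsub>C\<^esub> a = p \<cdot>\<^bsub>C\<^esub> b \<longrightarrow>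
       (\<exists>!u. u \<in> Hom C T P \<and> p' \<cdot>\<^bsub>C\<^esub> u = a \<and> f' \<cdot>\<^bsub>C\<^esub> u = b))"

text \<open>
  The square \<open>i' \<cdot> f = f' \<cdot> i\<close> with \<open>i : X \<rightarrow> Y\<close>, \<open>f : X \<rightarrow> X'\<close>, \<open>i' : X' \<rightarrow> P\<close>, \<open>f' : Y \<rightarrow> P\<close>
  is cocartesian.
\<close>

definition is_pushout ::
  "('o, 'm, 'e) category_scheme \<Rightarrow> 'o \<Rightarrow> 'm \<Rightarrow> 'm \<Rightarrow> 'o \<Rightarrow> 'o \<Rightarrow> 'm \<Rightarrow> 'm \<Rightarrow> 'o \<Rightarrow> bool" where
  "is_pushout C X i f X' Y i' f' P \<longleftrightarrow>
     i \<in> Hom C X Y \<and> f \<in> Hom C X X' \<and> i' \<in> Hom C X' P \<and> f' \<in> Hom C Y P \<and>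
     i' \<cdot>\<^bsub>C\<^esub> f = f' \<cdot>\<^bsub>C\<^esub> i \<and>
     (\<forall>T \<in> Obj C. \<forall>a \<in> Hom C X' T. \<forall>b \<in> Hom C Y T. a \<cdot>\<^bsub>C\<^esub> f = b \<cdot>\<^bsub>C\<^esub> i \<longrightarrow>
       (\<exists>!u. u \<in> Hom C P T \<and> u \<cdot>\<^bsub>C\<^esub> i' = a \<and> u \<cdot>\<^bsub>C\<^esub> f' = b))"

record ('o, 'm) preadditive = "('o, 'm) category" +
  Add :: "'m \<Rightarrow> 'm \<Rightarrow> 'm"  (infixl \<open>\<boxplus>\<index>\<close> 65)
  Zero :: "'o \<Rightarrow> 'o \<Rightarrow> 'm"

definition hom_group :: "('o, 'm, 'e) preadditive_scheme \<Rightarrow> 'o \<Rightarrow> 'o \<Rightarrow> 'm monoid" where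
  "hom_group C X Y = \<lparr>carrier = Hom C X Y, mult = Add C, one = Zero C X Y\<rparr>"

locale preadditive_category = category C
  for C :: "('o, 'm, 'e) preadditive_scheme" (structure) +
  assumes hom_comm_group: "X \<in> Obj C \<Longrightarrow> Y \<in> Obj C \<Longrightarrow> comm_group (hom_group C X Y)"
    and comp_add_right: "f \<in> Hom C X Y \<Longrightarrow> f' \<in> Hom C X Y \<Longrightarrow> g \<in> Hom C Y Z \<Longrightarrow>
      g \<cdot> (f \<boxplus> f') = g \<cdot> f \<boxplus> g \<cdot> f'"
    and comp_add_left: "f \<in> Hom C X Y \<Longrightarrow> g \<in> Hom C Y Z \<Longrightarrow> g' \<in> Hom C Y Z \<Longrightarrow>
      (g \<boxplus> g') \<cdot> f = g \<cdot> f \<boxplus> g' \<cdot> f"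

definition is_biproduct ::
  "('o, 'm, 'e) preadditive_scheme \<Rightarrow> 'o \<Rightarrow> 'o \<Rightarrow> 'o \<Rightarrow> 'm \<Rightarrow> 'm \<Rightarrow> 'm \<Rightarrow> 'm \<Rightarrow> bool" where
  "is_biproduct C A B D i\<^sub>A i\<^sub>B p\<^sub>A p\<^sub>B \<longleftrightarrow>
     i\<^sub>A \<in> Hom C A D \<and> i\<^sub>B \<in> Hom C B D \<and> p\<^sub>A \<in> Hom C D A \<and> p\<^sub>B \<in> Hom C D B \<and>
     p\<^sub>A \<cdot>\<^bsub>C\<^esub> i\<^sub>A = Ide C A \<and> p\<^sub>B \<cdot>\<^bsub>C\<^esub> i\<^sub>B = Ide C B \<and>
     p\<^sub>A \<cdot>\<^bsub>C\<^esub> i\<^sub>B = Zero C B A \<and> p\<^sub>B \<cdot>\<^bsub>C\<^esub> i\<^sub>A = Zero C A B \<and>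
     i\<^sub>A \<cdot>\<^bsub>C\<^esub> p\<^sub>A \<boxplus>\<^bsub>C\<^esub> i\<^sub>B \<cdot>\<^bsub>C\<^esub> p\<^sub>B = Ide C D"

locale additive_category = preadditive_category +
  assumes ex_zero_object: "\<exists>Z. zero_object C Z"
    and ex_biproduct: "A \<in> Obj C \<Longrightarrow> B \<in> Obj C \<Longrightarrow>
      \<exists>D i\<^sub>A i\<^sub>B p\<^sub>A p\<^sub>B. is_biproduct C A B D i\<^sub>A i\<^sub>B p\<^sub>A p\<^sub>B"


section \<open>Exact structures\<close>

definition is_kernel ::
  "('o, 'm, 'e) preadditive_scheme \<Rightarrow> 'o \<Rightarrow> 'm \<Rightarrow> 'o \<Rightarrow> 'm \<Rightarrow> 'o \<Rightarrow> bool" where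
  "is_kernel C X i Y p Z \<longleftrightarrow>
     i \<in> Hom C X Y \<and> p \<in> Hom C Y Z \<and> p \<cdot>\<^bsub>C\<^esub> i = Zero C X Z \<and>
     (\<forall>T \<in> Obj C. \<forall>t \<in> Hom C T Y. p \<cdot>\<^bsub>C\<^esub> t = Zero C T Z \<longrightarrow>
       (\<exists>!u. u \<in> Hom C T X \<and> i \<cdot>\<^bsub>C\<^esub> u = t))"

definition is_cokernel ::
  "('o, 'm, 'e) preadditive_scheme \<Rightarrow> 'o \<Rightarrow> 'm \<Rightarrow> 'o \<Rightarrow> 'm \<Rightarrow> 'o \<Rightarrow> bool" where
  "is_cokernel C X i Y p Z \<longleftrightarrow>
     i \<in> Hom C X Y \<and> p \<in> Hom C Y Z \<and> p \<cdot>\<^bsub>C\<^esub> i = Zero C X Z \<and>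
     (\<forall>T \<in> Obj C. \<forall>t \<in> Hom C Y T. t \<cdot>\<^bsub>C\<^esub> i = Zero C X T \<longrightarrow>
       (\<exists>!u. u \<in> Hom C Z T \<and> u \<cdot>\<^bsub>C\<^esub> p = t))"

text \<open>The tuple \<open>(X, i, Y, p, Z)\<close> stands for the sequence \<open>X \<rightarrow> Y \<rightarrow> Z\<close> with maps \<open>i\<close> and \<open>p\<close>.\<close>

type_synonym ('o, 'm) short_seq = "'o \<times> 'm \<times> 'o \<times> 'm \<times> 'o"

fun isomorphic_seqs ::
  "('o, 'm, 'e) category_scheme \<Rightarrow> ('o, 'm) short_seq \<Rightarrow> ('o, 'm) short_seq \<Rightarrow> bool" where
  "isomorphic_seqs C (X, i, Y, p, Z) (X', i', Y', p', Z') \<longleftrightarrow>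
     i \<in> Hom C X Y \<and> p \<in> Hom C Y Z \<and> i' \<in> Hom C X' Y' \<and> p' \<in> Hom C Y' Z' \<and>
     (\<exists>a b c. iso_arrow C X X' a \<and> iso_arrow C Y Y' b \<and> iso_arrow C Z Z' c \<and>
       b \<cdot>\<^bsub>C\<^esub> i = i' \<cdot>\<^bsub>C\<^esub> a \<and> c \<cdot>\<^bsub>C\<^esub> p = p' \<cdot>\<^bsub>C\<^esub> b)"

definition adm_mono :: "('o, 'm) short_seq set \<Rightarrow> 'o \<Rightarrow> 'm \<Rightarrow> 'o \<Rightarrow> bool" where
  "adm_mono S X i Y \<longleftrightarrow> (\<exists>p Z. (X, i, Y, p, Z) \<in> S)"

definition adm_epi :: "('o, 'm) short_seq set \<Rightarrow> 'o \<Rightarrow> 'm \<Rightarrow> 'o \<Rightarrow> bool" where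
  "adm_epi S Y p Z \<longleftrightarrow> (\<exists>X i. (X, i, Y, p, Z) \<in> S)"

text \<open>
  These are the axioms in Quillen's ``Higher algebraic K-theory I'', including the last pair,
  which Keller showed to follow from the others.
\<close>

locale exact_structure = additive_category C
  for C :: "('o, 'm, 'e) preadditive_scheme" (structure)
    and S :: "('o, 'm) short_seq set" +
  assumes iso_closed: "s \<in> S \<Longrightarrow> isomorphic_seqs C s t \<Longrightarrow> t \<in> S"
    and split_mem: "is_biproduct C A B D i\<^sub>A i\<^sub>B p\<^sub>A p\<^sub>B \<Longrightarrow> A \<in> Obj C \<Longrightarrow> B \<in> Obj C \<Longrightarrow>
      (A, i\<^sub>A, D, p\<^sub>B, B) \<in> S"
    and kernel: "(X, i, Y, p, Z) \<in> S \<Longrightarrow> is_kernel C X i Y p Z"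
    and cokernel: "(X, i, Y, p, Z) \<in> S \<Longrightarrow> is_cokernel C X i Y p Z"
    and epi_comp: "adm_epi S X p Y \<Longrightarrow> adm_epi S Y q Z \<Longrightarrow> adm_epi S X (q \<cdot> p) Z"
    and mono_comp: "adm_mono S X i Y \<Longrightarrow> adm_mono S Y j Z \<Longrightarrow> adm_mono S X (j \<cdot> i) Z"
    and ex_pullback: "adm_epi S Y p Z \<Longrightarrow> f \<in> Hom C Z' Z \<Longrightarrow>
      \<exists>P p' f'. is_pullback C P p' f' Z' Y p f Z"
    and epi_pullback: "adm_epi S Y p Z \<Longrightarrow> is_pullback C P p' f' Z' Y p f Z \<Longrightarrow>
      adm_epi S P p' Z'"
    and ex_pushout: "adm_mono S X i Y \<Longrightarrow> f \<in> Hom C X X' \<Longrightarrow>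
      \<exists>P i' f'. is_pushout C X i f X' Y i' f' P"
    and mono_pushout: "adm_mono S X i Y \<Longrightarrow> is_pushout C X i f X' Y i' f' P \<Longrightarrow>
      adm_mono S X' i' P"
    and epi_cancel: "is_kernel C K k Y p Z \<Longrightarrow> e \<in> Hom C W Y \<Longrightarrow> adm_epi S W (p \<cdot> e) Z \<Longrightarrow>
      adm_epi S Y p Z"
    and mono_cancel: "is_cokernel C X i Y q Q \<Longrightarrow> m \<in> Hom C Y W \<Longrightarrow> adm_mono S X (m \<cdot> i) W \<Longrightarrow>
      adm_mono S X i Y"

definition rel_projective ::
  "('o, 'm, 'e) category_scheme \<Rightarrow> ('o, 'm) short_seq set \<Rightarrow> 'o \<Rightarrow> bool" where
  "rel_projective C S P \<longleftrightarrow> P \<in> Obj C \<and>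
     (\<forall>Y p Z. adm_epi S Y p Z \<longrightarrow> (\<forall>f \<in> Hom C P Z. \<exists>g \<in> Hom C P Y. p \<cdot>\<^bsub>C\<^esub> g = f))"

definition rel_injective ::
  "('o, 'm, 'e) category_scheme \<Rightarrow> ('o, 'm) short_seq set \<Rightarrow> 'o \<Rightarrow> bool" where
  "rel_injective C S I \<longleftrightarrow> I \<in> Obj C \<and>
     (\<forall>X i Y. adm_mono S X i Y \<longrightarrow> (\<forall>f \<in> Hom C X I. \<exists>g \<in> Hom C Y I. g \<cdot>\<^bsub>C\<^esub> i = f))"

locale frobenius_exact_structure = exact_structure +
  assumes enough_projectives: "X \<in> Obj C \<Longrightarrow> \<exists>P p. rel_projective C S P \<and> adm_epi S P p X"
    and enough_injectives: "X \<in> Obj C \<Longrightarrow> \<exists>I i. rel_injective C S I \<and> adm_mono S X i I"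
    and projective_iff_injective: "rel_projective C S X \<longleftrightarrow> rel_injective C S X"


section \<open>N-complexes\<close>

record ('o, 'm) cplx =
  ob :: "int \<Rightarrow> 'o"
  diff :: "int \<Rightarrow> 'm"

text \<open>\<open>diff_pow A X k n\<close> is the \<open>k\<close>-fold differential from degree \<open>n\<close> to degree \<open>n + k\<close>.\<close>

primrec diff_pow ::
  "('o, 'm, 'e) category_scheme \<Rightarrow> ('o, 'm) cplx \<Rightarrow> nat \<Rightarrow> int \<Rightarrow> 'm" where
  "diff_pow A X 0 n = Ide A (ob X n)"
| "diff_pow A X (Suc k) n = diff X (n + int k) \<cdot>\<^bsub>A\<^esub> diff_pow A X k n"

definition is_ncomplex ::
  "nat \<Rightarrow> ('o, 'm, 'e) preadditive_scheme \<Rightarrow> ('o, 'm) cplx \<Rightarrow> bool" where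
  "is_ncomplex N A X \<longleftrightarrow>
     (\<forall>n. ob X n \<in> Obj A) \<and> (\<forall>n. diff X n \<in> Hom A (ob X n) (ob X (n + 1))) \<and>
     (\<forall>n. diff_pow A X N n = Zero A (ob X n) (ob X (n + int N)))"

definition ncomplex_hom ::
  "nat \<Rightarrow> ('o, 'm, 'e) preadditive_scheme \<Rightarrow> ('o, 'm) cplx \<Rightarrow> ('o, 'm) cplx \<Rightarrow> (int \<Rightarrow> 'm) set" where
  "ncomplex_hom N A X Y = {g. is_ncomplex N A X \<and> is_ncomplex N A Y \<and>
     (\<forall>n. g n \<in> Hom A (ob X n) (ob Y n)) \<and>
     (\<forall>n. g (n + 1) \<cdot>\<^bsub>A\<^esub> diff X n = diff Y n \<cdot>\<^bsub>A\<^esub> g n)}"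

definition ncomplexes ::
  "nat \<Rightarrow> ('o, 'm, 'e) preadditive_scheme \<Rightarrow> (('o, 'm) cplx, int \<Rightarrow> 'm) preadditive" where
  "ncomplexes N A =
     \<lparr>Obj = {X. is_ncomplex N A X},
      Hom = ncomplex_hom N A,
      Ide = (\<lambda>X n. Ide A (ob X n)),
      Comp = (\<lambda>g f n. g n \<cdot>\<^bsub>A\<^esub> f n),
      Add = (\<lambda>f g n. f n \<boxplus>\<^bsub>A\<^esub> g n),
      Zero = (\<lambda>X Y n. Zero A (ob X n) (ob Y n))\<rparr>"

definition is_split_seq ::
  "('o, 'm, 'e) preadditive_scheme \<Rightarrow> ('o, 'm) short_seq \<Rightarrow> bool" where
  "is_split_seq A s \<longleftrightarrow> (\<exists>U V D i\<^sub>U i\<^sub>V p\<^sub>U p\<^sub>V. U \<in> Obj A \<and> V \<in> Obj A \<and>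
     is_biproduct A U V D i\<^sub>U i\<^sub>V p\<^sub>U p\<^sub>V \<and> isomorphic_seqs A s (U, i\<^sub>U, D, p\<^sub>V, V))"

definition levelwise_split ::
  "nat \<Rightarrow> ('o, 'm, 'e) preadditive_scheme \<Rightarrow> (('o, 'm) cplx, int \<Rightarrow> 'm) short_seq set" where
  "levelwise_split N A = {(X, f, Y, g, Z).
     f \<in> Hom (ncomplexes N A) X Y \<and> g \<in> Hom (ncomplexes N A) Y Z \<and>
     (\<forall>n. is_split_seq A (ob X n, f n, ob Y n, g n, ob Z n))}"

end

theory Submission
  imports Defs
begin

text \<open>
  Write \<open>A\<close> for the additive base category and \<open>C\<close> for the category of \<open>N\<close>-complexes in \<open>A\<close>. The
  theorem comes down to three observations.

  \<^emph>\<open>Admissible epimorphisms are a degreewise notion.\<close> A map of complexes is an admissible epimorphism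
  exactly if in every degree it is a split epimorphism that has a kernel
  (\<open>levelwise_adm_epi_iff\<close>): the degreewise kernels assemble to a complex by their universal property,
  and a split epimorphism with a kernel is the projection of a biproduct. In \<open>A\<close>, pullbacks of
  such split epimorphisms exist, and composites and pullbacks of them are of the same kind.

  \<^emph>\<open>Evaluation at a degree preserves limits.\<close> Stability of admissible epimorphisms under
  arbitrary pullbacks in \<open>C\<close>, and the cancellation axiom, require pullbacks and kernels in \<open>C\<close> to be
  degreewise ones (\<open>pullback_level\<close>, \<open>kernel_level\<close>). They are, because evaluation at degree \<open>n\<close> has a
  left adjoint, sending \<open>T\<close> to the string of identities \<open>T \<rightarrow> T \<rightarrow> \<dots> \<rightarrow> T\<close> of length \<open>N\<close> that
  starts in degree \<open>n\<close>. Cancellation is then immediate: if \<open>p e\<close> is split in each degree, so is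
  \<open>p\<close>, and \<open>p\<close> has a kernel in each degree.

  \<^emph>\<open>Free complexes are projective and injective.\<close> The direct sum of such strings on a family \<open>U\<close> of
  objects, one starting in each degree, is degreewise a finite biproduct and hence exists over \<open>A\<close>.
  A map out of it is an arbitrary family of maps out of the \<open>U n\<close>, which can be lifted along a
  degreewise split epimorphism (\<open>free_complex_projective\<close>). The identities of the objects of \<open>X\<close>
  extend to an admissible epimorphism onto \<open>X\<close> (\<open>free_cover\<close>). So there are enough projectives, and
  every projective is a retract of a free complex. A string is also cofree on its last term,
  which makes free complexes self-dual (\<open>dual_free_complex\<close>) and hence injective. It follows that
  projectives are injective.

  The other halves of the axioms follow by duality: negating the degrees identifies the opposite
  of \<open>C\<close> with the category of \<open>N\<close>-complexes in the opposite of \<open>A\<close>, and exchanges admissible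
  monomorphisms and epimorphisms. For \<open>N = 0\<close> all complexes are zero and all strings are empty, and
  the same arguments apply.
\<close>

section \<open>Calculus in a preadditive category\<close>

context preadditive_category
begin

lemma hom_obj1: "f \<in> Hom C X Y \<Longrightarrow> X \<in> Obj C"
  and hom_obj2: "f \<in> Hom C X Y \<Longrightarrow> Y \<in> Obj C"
  using hom_obj by blast+

lemma zero_hom: "X \<in> Obj C \<Longrightarrow> Y \<in> Obj C \<Longrightarrow> Zero C X Y \<in> Hom C X Y"
  using comm_groupE(2)[OF hom_comm_group] by (simp add: hom_group_def)

lemma add_hom: "f \<in> Hom C X Y \<Longrightarrow> g \<in> Hom C X Y \<Longrightarrow> f \<boxplus> g \<in> Hom C X Y"
  using comm_groupE(1)[OF hom_comm_group[of X Y], of f g] by (auto simp: hom_group_def dest: hom_obj)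

lemma add_assoc: "f \<in> Hom C X Y \<Longrightarrow> g \<in> Hom C X Y \<Longrightarrow> h \<in> Hom C X Y \<Longrightarrow>
    (f \<boxplus> g) \<boxplus> h = f \<boxplus> (g \<boxplus> h)"
  using comm_groupE(3)[OF hom_comm_group[of X Y], of f g h] by (auto simp: hom_group_def dest: hom_obj)

lemma add_comm: "f \<in> Hom C X Y \<Longrightarrow> g \<in> Hom C X Y \<Longrightarrow> f \<boxplus> g = g \<boxplus> f"
  using comm_groupE(4)[OF hom_comm_group[of X Y], of f g] by (auto simp: hom_group_def dest: hom_obj)

lemma add_zero_left: "f \<in> Hom C X Y \<Longrightarrow> Zero C X Y \<boxplus> f = f"
  using comm_groupE(5)[OF hom_comm_group[of X Y], of f] by (auto simp: hom_group_def dest: hom_obj)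

lemma add_zero_right: "f \<in> Hom C X Y \<Longrightarrow> f \<boxplus> Zero C X Y = f"
  using add_zero_left add_comm zero_hom hom_obj by metis

lemma ex_neg: "f \<in> Hom C X Y \<Longrightarrow> \<exists>g \<in> Hom C X Y. g \<boxplus> f = Zero C X Y"
  using comm_groupE(6)[OF hom_comm_group[of X Y], of f] by (auto simp: hom_group_def dest: hom_obj)

lemma add_idem_zero:
  assumes f: "f \<in> Hom C X Y" and eq: "f \<boxplus> f = f"
  shows "f = Zero C X Y"
proof -
  obtain g where g: "g \<in> Hom C X Y" "g \<boxplus> f = Zero C X Y"
    using ex_neg[OF f] by blast
  have "f = (g \<boxplus> f) \<boxplus> f" using g f by (simp add: add_zero_left)
  also have "\<dots> = g \<boxplus> f" using add_assoc[OF g(1) f f] eq by simp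
  finally show ?thesis using g by simp
qed

lemma comp_zero_right:
  assumes "g \<in> Hom C Y Z" "X \<in> Obj C"
  shows "g \<cdot> Zero C X Y = Zero C X Z"
proof -
  have z: "Zero C X Y \<in> Hom C X Y" using assms hom_obj1 zero_hom by blast
  show ?thesis
    using add_idem_zero[OF comp_hom[OF z assms(1)]] comp_add_right[OF z z assms(1)]
      add_zero_left[OF z] by simp
qed

lemma comp_zero_left:
  assumes "f \<in> Hom C X Y" "Z \<in> Obj C"
  shows "Zero C Y Z \<cdot> f = Zero C X Z"
proof -
  have z: "Zero C Y Z \<in> Hom C Y Z" using assms hom_obj2 zero_hom by blast
  show ?thesis
    using add_idem_zero[OF comp_hom[OF assms(1) z]] comp_add_left[OF assms(1) z z]
      add_zero_left[OF z] by simp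
qed

lemma biproductD:
  assumes "is_biproduct C A B D i j p q"
  shows "i \<in> Hom C A D" "j \<in> Hom C B D" "p \<in> Hom C D A" "q \<in> Hom C D B"
    "p \<cdot> i = Ide C A" "q \<cdot> j = Ide C B" "p \<cdot> j = Zero C B A" "q \<cdot> i = Zero C A B"
    "i \<cdot> p \<boxplus> j \<cdot> q = Ide C D"
    "A \<in> Obj C" "B \<in> Obj C" "D \<in> Obj C"
proof -
  show "i \<in> Hom C A D" "j \<in> Hom C B D" "p \<in> Hom C D A" "q \<in> Hom C D B"
    "p \<cdot> i = Ide C A" "q \<cdot> j = Ide C B" "p \<cdot> j = Zero C B A" "q \<cdot> i = Zero C A B"
    "i \<cdot> p \<boxplus> j \<cdot> q = Ide C D"
    using assms by (simp_all add: is_biproduct_def)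
  then show "A \<in> Obj C" "B \<in> Obj C" "D \<in> Obj C" using hom_obj1 by blast+
qed

lemma biproduct_decompose:
  assumes b: "is_biproduct C A B D i j p q" and u: "u \<in> Hom C T D"
  shows "u = i \<cdot> (p \<cdot> u) \<boxplus> j \<cdot> (q \<cdot> u)"
proof -
  note B = biproductD[OF b]
  have "u = (i \<cdot> p \<boxplus> j \<cdot> q) \<cdot> u" using B(9) comp_ide_left[OF u] by simp
  also have "\<dots> = (i \<cdot> p) \<cdot> u \<boxplus> (j \<cdot> q) \<cdot> u"
    by (rule comp_add_left[OF u comp_hom[OF B(3,1)] comp_hom[OF B(4,2)]])
  also have "\<dots> = i \<cdot> (p \<cdot> u) \<boxplus> j \<cdot> (q \<cdot> u)"
    using comp_assoc[OF u B(3,1)] comp_assoc[OF u B(4,2)] by simp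
  finally show ?thesis .
qed

lemma biproduct_pairing:
  assumes b: "is_biproduct C A B D i j p q" and a: "a \<in> Hom C T A" "b \<in> Hom C T B"
  shows "\<exists>!u. u \<in> Hom C T D \<and> p \<cdot> u = a \<and> q \<cdot> u = b"
proof -
  note B = biproductD[OF b]
  have h: "i \<cdot> a \<in> Hom C T D" "j \<cdot> b \<in> Hom C T D"
    using comp_hom[OF a(1) B(1)] comp_hom[OF a(2) B(2)] by auto
  have "p \<cdot> (i \<cdot> a) = a" "q \<cdot> (j \<cdot> b) = b"
    using comp_assoc[OF a(1) B(1,3)] comp_assoc[OF a(2) B(2,4)] B(5,6)
      comp_ide_left[OF a(1)] comp_ide_left[OF a(2)] by simp_all
  moreover have "p \<cdot> (j \<cdot> b) = Zero C T A" "q \<cdot> (i \<cdot> a) = Zero C T B"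
    using comp_assoc[OF a(2) B(2,3)] comp_assoc[OF a(1) B(1,4)] B(7,8)
      comp_zero_left[OF a(2) B(10)] comp_zero_left[OF a(1) B(11)] by simp_all
  ultimately have "p \<cdot> (i \<cdot> a \<boxplus> j \<cdot> b) = a" "q \<cdot> (i \<cdot> a \<boxplus> j \<cdot> b) = b"
    using comp_add_right[OF h B(3)] comp_add_right[OF h B(4)] add_zero_right[OF a(1)]
      add_zero_left[OF a(2)] by simp_all
  then show ?thesis
    using add_hom[OF h] by (intro ex1I[of _ "i \<cdot> a \<boxplus> j \<cdot> b"]) (auto dest: biproduct_decompose[OF b])
qed

lemma biproduct_jointly_monic:
  assumes "is_biproduct C A B D i j p q" "u \<in> Hom C T D" "v \<in> Hom C T D"
    "p \<cdot> u = p \<cdot> v" "q \<cdot> u = q \<cdot> v"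
  shows "u = v"
  using biproduct_decompose[OF assms(1)] assms by metis

lemma kernelD:
  assumes "is_kernel C X i Y p Z"
  shows "i \<in> Hom C X Y" "p \<in> Hom C Y Z" "p \<cdot> i = Zero C X Z"
    "t \<in> Hom C T Y \<Longrightarrow> p \<cdot> t = Zero C T Z \<Longrightarrow> \<exists>u \<in> Hom C T X. i \<cdot> u = t"
    "u \<in> Hom C T X \<Longrightarrow> v \<in> Hom C T X \<Longrightarrow> i \<cdot> u = i \<cdot> v \<Longrightarrow> u = v"
proof -
  show K: "i \<in> Hom C X Y" "p \<in> Hom C Y Z" "p \<cdot> i = Zero C X Z"
    using assms by (auto simp: is_kernel_def)
  show "t \<in> Hom C T Y \<Longrightarrow> p \<cdot> t = Zero C T Z \<Longrightarrow> \<exists>u \<in> Hom C T X. i \<cdot> u = t"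
    using assms hom_obj1 unfolding is_kernel_def by blast
  assume uv: "u \<in> Hom C T X" "v \<in> Hom C T X" "i \<cdot> u = i \<cdot> v"
  have "p \<cdot> (i \<cdot> u) = Zero C T Z"
    using comp_assoc[OF uv(1) K(1,2)] K(3) comp_zero_left[OF uv(1)] hom_obj2[OF K(2)] by simp
  then have "\<exists>!w. w \<in> Hom C T X \<and> i \<cdot> w = i \<cdot> u"
    using assms comp_hom[OF uv(1) K(1)] hom_obj1[OF uv(1)] unfolding is_kernel_def by blast
  then show "u = v" using uv by metis
qed

lemma kernelI:
  assumes K: "i \<in> Hom C X Y" "p \<in> Hom C Y Z" "p \<cdot> i = Zero C X Z"
    and "\<And>t T. t \<in> Hom C T Y \<Longrightarrow> p \<cdot> t = Zero C T Z \<Longrightarrow> \<exists>u \<in> Hom C T X. i \<cdot> u = t"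
    and "\<And>u v T. u \<in> Hom C T X \<Longrightarrow> v \<in> Hom C T X \<Longrightarrow> i \<cdot> u = i \<cdot> v \<Longrightarrow> u = v"
  shows "is_kernel C X i Y p Z"
  unfolding is_kernel_def using assms by blast

lemma pullbackD:
  assumes "is_pullback C P p' f' Z' Y p f Z"
  shows "p' \<in> Hom C P Z'" "f' \<in> Hom C P Y" "p \<in> Hom C Y Z" "f \<in> Hom C Z' Z"
    "f \<cdot> p' = p \<cdot> f'"
    "a \<in> Hom C T Z' \<Longrightarrow> b \<in> Hom C T Y \<Longrightarrow> f \<cdot> a = p \<cdot> b \<Longrightarrow>
      \<exists>u \<in> Hom C T P. p' \<cdot> u = a \<and> f' \<cdot> u = b"
    "u \<in> Hom C T P \<Longrightarrow> v \<in> Hom C T P \<Longrightarrow> p' \<cdot> u = p' \<cdot> v \<Longrightarrow> f' \<cdot> u = f' \<cdot> v \<Longrightarrow> u = v"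
proof -
  show K: "p' \<in> Hom C P Z'" "f' \<in> Hom C P Y" "p \<in> Hom C Y Z" "f \<in> Hom C Z' Z"
    "f \<cdot> p' = p \<cdot> f'"
    using assms by (auto simp: is_pullback_def)
  show "a \<in> Hom C T Z' \<Longrightarrow> b \<in> Hom C T Y \<Longrightarrow> f \<cdot> a = p \<cdot> b \<Longrightarrow>
      \<exists>u \<in> Hom C T P. p' \<cdot> u = a \<and> f' \<cdot> u = b"
    using assms hom_obj1 unfolding is_pullback_def by blast
  assume uv: "u \<in> Hom C T P" "v \<in> Hom C T P" "p' \<cdot> u = p' \<cdot> v" "f' \<cdot> u = f' \<cdot> v"
  have "f \<cdot> (p' \<cdot> u) = p \<cdot> (f' \<cdot> u)"
    using comp_assoc[OF uv(1) K(1,4)] comp_assoc[OF uv(1) K(2,3)] K(5) by simp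
  then have "\<exists>!w. w \<in> Hom C T P \<and> p' \<cdot> w = p' \<cdot> u \<and> f' \<cdot> w = f' \<cdot> u"
    using assms comp_hom[OF uv(1) K(1)] comp_hom[OF uv(1) K(2)] hom_obj1[OF uv(1)]
    unfolding is_pullback_def by blast
  then show "u = v" using uv by metis
qed

lemma pullbackI:
  assumes "p' \<in> Hom C P Z'" "f' \<in> Hom C P Y" "p \<in> Hom C Y Z" "f \<in> Hom C Z' Z"
    "f \<cdot> p' = p \<cdot> f'"
    "\<And>a b T. a \<in> Hom C T Z' \<Longrightarrow> b \<in> Hom C T Y \<Longrightarrow> f \<cdot> a = p \<cdot> b \<Longrightarrow>
      \<exists>u \<in> Hom C T P. p' \<cdot> u = a \<and> f' \<cdot> u = b"
    "\<And>u v T. u \<in> Hom C T P \<Longrightarrow> v \<in> Hom C T P \<Longrightarrow> p' \<cdot> u = p' \<cdot> v \<Longrightarrow> f' \<cdot> u = f' \<cdot> v \<Longrightarrow> u = v"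
  shows "is_pullback C P p' f' Z' Y p f Z"
  unfolding is_pullback_def
proof (intro conjI ballI impI)
  fix T a b
  assume ab: "a \<in> Hom C T Z'" "b \<in> Hom C T Y" "f \<cdot> a = p \<cdot> b"
  from assms(6)[OF this] obtain u where "u \<in> Hom C T P" "p' \<cdot> u = a" "f' \<cdot> u = b" by blast
  then show "\<exists>!u. u \<in> Hom C T P \<and> p' \<cdot> u = a \<and> f' \<cdot> u = b"
    using assms(7) by (intro ex1I[of _ u]) auto
qed (fact assms)+

lemma biproduct_kernel:
  assumes b: "is_biproduct C X Z Y i s r p"
  shows "is_kernel C X i Y p Z"
proof -
  note B = biproductD[OF b]
  have ri: "r \<cdot> (i \<cdot> u) = u" if "u \<in> Hom C T X" for u T
    using comp_assoc[OF that B(1,3)] B(5) comp_ide_left[OF that] by metis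
  have factor: "\<exists>u \<in> Hom C T X. i \<cdot> u = t" if t: "t \<in> Hom C T Y" "p \<cdot> t = Zero C T Z" for t T
  proof
    show rt: "r \<cdot> t \<in> Hom C T X" using comp_hom[OF t(1) B(3)] .
    show "i \<cdot> (r \<cdot> t) = t"
    proof (rule biproduct_jointly_monic[OF b comp_hom[OF rt B(1)] t(1)])
      show "r \<cdot> (i \<cdot> (r \<cdot> t)) = r \<cdot> t" using ri rt by blast
      show "p \<cdot> (i \<cdot> (r \<cdot> t)) = p \<cdot> t"
        using comp_assoc[OF rt B(1,4)] B(8) comp_zero_left[OF rt B(11)] t by simp
    qed
  qed
  show ?thesis
  proof (rule kernelI[OF B(1,4,8) factor])
    fix u v T assume "u \<in> Hom C T X" "v \<in> Hom C T X" "i \<cdot> u = i \<cdot> v"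
    then show "u = v" using ri by metis
  qed
qed

text \<open>
  The retraction is the factorisation of \<open>1 - s p\<close> through the kernel. This is where a kernel is
  indispensable: a section alone makes \<open>s p\<close> an idempotent, which need not split.
\<close>

lemma biproduct_of_kernel_section:
  assumes k: "is_kernel C K k Y p Z" and s: "s \<in> Hom C Z Y" "p \<cdot> s = Ide C Z"
  shows "\<exists>r. is_biproduct C K Z Y k s r p"
proof -
  note K = kernelD[OF k]
  have obj: "K \<in> Obj C" "Y \<in> Obj C" "Z \<in> Obj C"
    using hom_obj1[OF K(1)] hom_obj1[OF s(1)] hom_obj2[OF s(1)] by auto
  have sp: "s \<cdot> p \<in> Hom C Y Y" using comp_hom[OF K(2) s(1)] .
  obtain n where n: "n \<in> Hom C Y Y" "n \<boxplus> s \<cdot> p = Zero C Y Y" using ex_neg[OF sp] by blast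
  \<comment> \<open>\<open>n\<close> is \<open>- s p\<close>, and \<open>e\<close> is the complementary idempotent \<open>1 - s p\<close>.\<close>
  define e where "e = Ide C Y \<boxplus> n"
  have e: "e \<in> Hom C Y Y" unfolding e_def using add_hom ide_hom n obj by blast
  have esp: "e \<boxplus> s \<cdot> p = Ide C Y"
    unfolding e_def using add_assoc[OF ide_hom[OF obj(2)] n(1) sp] n(2)
      add_zero_right[OF ide_hom[OF obj(2)]] by simp
  have psp: "p \<cdot> (s \<cdot> p) = p"
    using comp_assoc[OF K(2) s(1) K(2)] s(2) comp_ide_left[OF K(2)] by simp
  have pe: "p \<cdot> e = Zero C Y Z"
  proof -
    have "p \<cdot> e = p \<boxplus> p \<cdot> n"
      unfolding e_def using comp_add_right[OF ide_hom[OF obj(2)] n(1) K(2)] comp_ide_right[OF K(2)] by simp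
    also have "\<dots> = p \<cdot> n \<boxplus> p \<cdot> (s \<cdot> p)"
      using add_comm[OF K(2) comp_hom[OF n(1) K(2)]] psp by simp
    also have "\<dots> = p \<cdot> Zero C Y Y" using comp_add_right[OF n(1) sp K(2)] n(2) by simp
    finally show ?thesis using comp_zero_right[OF K(2) obj(2)] by simp
  qed
  obtain r where r: "r \<in> Hom C Y K" "k \<cdot> r = e" using K(4)[OF e pe] by blast
  have ek: "e \<cdot> k = k"
  proof -
    have "(s \<cdot> p) \<cdot> k = Zero C K Y"
      using comp_assoc[OF K(1,2) s(1)] K(3) comp_zero_right[OF s(1) obj(1)] by simp
    then have "(e \<boxplus> s \<cdot> p) \<cdot> k = e \<cdot> k"
      using comp_add_left[OF K(1) e sp] add_zero_right[OF comp_hom[OF K(1) e]] by simp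
    then show ?thesis using esp comp_ide_left[OF K(1)] by simp
  qed
  have es: "e \<cdot> s = Zero C Z Y"
  proof -
    have sps: "(s \<cdot> p) \<cdot> s = s" using comp_assoc[OF s(1) K(2) s(1)] s(2) comp_ide_right[OF s(1)] by simp
    have "n \<cdot> s \<boxplus> s = Zero C Z Y"
      using comp_add_left[OF s(1) n(1) sp] sps n(2) comp_zero_left[OF s(1) obj(2)] by simp
    moreover have "e \<cdot> s = s \<boxplus> n \<cdot> s"
      unfolding e_def using comp_add_left[OF s(1) ide_hom[OF obj(2)] n(1)] comp_ide_left[OF s(1)] by simp
    ultimately show ?thesis using add_comm[OF s(1) comp_hom[OF s(1) n(1)]] by simp
  qed
  have "r \<cdot> k = Ide C K"
  proof (rule K(5))
    show "r \<cdot> k \<in> Hom C K K" "Ide C K \<in> Hom C K K" using comp_hom[OF K(1) r(1)] ide_hom[OF obj(1)] by auto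
    show "k \<cdot> (r \<cdot> k) = k \<cdot> Ide C K"
      using comp_assoc[OF K(1) r(1) K(1)] r(2) ek comp_ide_right[OF K(1)] by simp
  qed
  moreover have "r \<cdot> s = Zero C Z K"
  proof (rule K(5))
    show "r \<cdot> s \<in> Hom C Z K" "Zero C Z K \<in> Hom C Z K" using comp_hom[OF s(1) r(1)] zero_hom[OF obj(3,1)] by auto
    show "k \<cdot> (r \<cdot> s) = k \<cdot> Zero C Z K"
      using comp_assoc[OF s(1) r(1) K(1)] r(2) es comp_zero_right[OF K(1) obj(3)] by simp
  qed
  ultimately have "is_biproduct C K Z Y k s r p"
    unfolding is_biproduct_def using K(1-3) s r esp by auto
  then show ?thesis by blast
qed

end


section \<open>The opposite category\<close>

definition opposite :: "('o, 'm, 'e) preadditive_scheme \<Rightarrow> ('o, 'm) preadditive" where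
  "opposite C =
     \<lparr>Obj = Obj C, Hom = (\<lambda>X Y. Hom C Y X), Ide = Ide C, Comp = (\<lambda>g f. f \<cdot>\<^bsub>C\<^esub> g),
      Add = Add C, Zero = (\<lambda>X Y. Zero C Y X)\<rparr>"

lemma opposite_simps [simp]:
  "Obj (opposite C) = Obj C" "Hom (opposite C) X Y = Hom C Y X" "Ide (opposite C) = Ide C"
  "Comp (opposite C) g f = f \<cdot>\<^bsub>C\<^esub> g" "Add (opposite C) = Add C"
  "Zero (opposite C) X Y = Zero C Y X"
  by (simp_all add: opposite_def)

context preadditive_category
begin

lemma opposite_preadditive: "preadditive_category (opposite C)"
proof (intro preadditive_category.intro category.intro preadditive_category_axioms.intro)
  fix X Y assume "X \<in> Obj (opposite C)" "Y \<in> Obj (opposite C)"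
  then show "comm_group (hom_group (opposite C) X Y)"
    using hom_comm_group[of Y X] by (simp add: hom_group_def)
qed (auto simp: comp_ide_left comp_ide_right comp_assoc comp_add_left comp_add_right
    dest: hom_obj intro: ide_hom comp_hom)

lemma opposite_biproduct:
  assumes "is_biproduct C A B D i j p q"
  shows "is_biproduct (opposite C) B A D q p j i"
proof -
  note B = biproductD[OF assms]
  show ?thesis
    using B add_comm[OF comp_hom[OF B(3,1)] comp_hom[OF B(4,2)]] by (simp add: is_biproduct_def)
qed

lemma biproduct_copairing:
  assumes "is_biproduct C A B D i j p q" "a \<in> Hom C A T" "b \<in> Hom C B T"
  shows "\<exists>!u. u \<in> Hom C D T \<and> u \<cdot> i = a \<and> u \<cdot> j = b"
  using preadditive_category.biproduct_pairing[OF opposite_preadditive opposite_biproduct[OF assms(1)],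
      of b T a] assms by (simp add: conj_commute)

lemma biproduct_jointly_epic:
  assumes "is_biproduct C A B D i j p q" "u \<in> Hom C D T" "v \<in> Hom C D T"
    "u \<cdot> i = v \<cdot> i" "u \<cdot> j = v \<cdot> j"
  shows "u = v"
  using preadditive_category.biproduct_jointly_monic[OF opposite_preadditive
      opposite_biproduct[OF assms(1)], of u T v] assms by simp

lemma biproduct_swap:
  assumes "is_biproduct C A B D i j p q"
  shows "is_biproduct C B A D j i q p"
proof -
  note B = biproductD[OF assms]
  show ?thesis
    using B add_comm[OF comp_hom[OF B(3,1)] comp_hom[OF B(4,2)]] by (simp add: is_biproduct_def)
qed

end

lemma (in additive_category) opposite_additive: "additive_category (opposite C)"
proof (intro additive_category.intro opposite_preadditive additive_category_axioms.intro)
  show "\<exists>Z. zero_object (opposite C) Z"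
    using ex_zero_object by (simp add: zero_object_def conj_commute)
next
  fix A B assume "A \<in> Obj (opposite C)" "B \<in> Obj (opposite C)"
  then have "B \<in> Obj C" "A \<in> Obj C" by simp_all
  from ex_biproduct[OF this] opposite_biproduct
  show "\<exists>D i j p q. is_biproduct (opposite C) A B D i j p q" by metis
qed


section \<open>Split epimorphisms with a kernel\<close>

text \<open>
  The base category need not be idempotent complete, so that a split epimorphism need not have a
  kernel. Those that have one are the projections of biproducts.
\<close>

definition split_epi :: "('o, 'm, 'e) preadditive_scheme \<Rightarrow> 'o \<Rightarrow> 'm \<Rightarrow> 'o \<Rightarrow> bool" where
  "split_epi C Y p Z \<longleftrightarrow> (\<exists>X i s r. is_biproduct C X Z Y i s r p)"

context preadditive_category
begin

lemma split_epiI: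
  "is_kernel C K k Y p Z \<Longrightarrow> s \<in> Hom C Z Y \<Longrightarrow> p \<cdot> s = Ide C Z \<Longrightarrow> split_epi C Y p Z"
  unfolding split_epi_def using biproduct_of_kernel_section by blast

lemma split_epiE:
  assumes "split_epi C Y p Z"
  obtains K k s where "is_kernel C K k Y p Z" "s \<in> Hom C Z Y" "p \<cdot> s = Ide C Z"
proof -
  obtain X i s r where b: "is_biproduct C X Z Y i s r p"
    using assms unfolding split_epi_def by blast
  show thesis by (rule that[OF biproduct_kernel[OF b] biproductD(2,6)[OF b]])
qed

text \<open>
  A map into the pullback that is killed by \<open>p'\<close> is determined by its other component, which is
  killed by \<open>p\<close>. So \<open>p'\<close> and \<open>p\<close> share the kernel object \<open>X\<close>.
\<close>

lemma pullback_kernel: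
  assumes pb: "is_pullback C P p' f' Z' Y p f Z" and k: "is_kernel C X i Y p Z"
  shows "\<exists>i'. is_kernel C X i' P p' Z'"
proof -
  note P = pullbackD[OF pb] and K = kernelD[OF k]
  note X = hom_obj1[OF K(1)] and Z' = hom_obj1[OF P(4)]
  have "f \<cdot> Zero C X Z' = p \<cdot> i" using comp_zero_right[OF P(4) X] K(3) by simp
  then obtain i' where i': "i' \<in> Hom C X P" "p' \<cdot> i' = Zero C X Z'" "f' \<cdot> i' = i"
    using P(6)[OF zero_hom[OF X Z'] K(1)] by blast
  have "is_kernel C X i' P p' Z'"
  proof (rule kernelI[OF i'(1) P(1) i'(2)])
    fix t T assume t: "t \<in> Hom C T P" "p' \<cdot> t = Zero C T Z'"
    have "p \<cdot> (f' \<cdot> t) = f \<cdot> (p' \<cdot> t)"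
      using comp_assoc[OF t(1) P(1) P(4)] comp_assoc[OF t(1) P(2) P(3)] P(5) by metis
    also have "\<dots> = Zero C T Z" using t(2) comp_zero_right[OF P(4) hom_obj1[OF t(1)]] by simp
    finally obtain u where u: "u \<in> Hom C T X" "i \<cdot> u = f' \<cdot> t"
      using K(4)[OF comp_hom[OF t(1) P(2)]] by blast
    have "p' \<cdot> (i' \<cdot> u) = p' \<cdot> t"
      using comp_assoc[OF u(1) i'(1) P(1)] i'(2) comp_zero_left[OF u(1) Z'] t(2) by metis
    moreover have "f' \<cdot> (i' \<cdot> u) = f' \<cdot> t"
      using comp_assoc[OF u(1) i'(1) P(2)] i'(3) u(2) by metis
    ultimately have "i' \<cdot> u = t" using P(7)[OF comp_hom[OF u(1) i'(1)] t(1)] by blast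
    then show "\<exists>u \<in> Hom C T X. i' \<cdot> u = t" using u(1) by blast
  next
    fix u v T assume uv: "u \<in> Hom C T X" "v \<in> Hom C T X" "i' \<cdot> u = i' \<cdot> v"
    have "i \<cdot> u = i \<cdot> v"
      using comp_assoc[OF uv(1) i'(1) P(2)] comp_assoc[OF uv(2) i'(1) P(2)] i'(3) uv(3) by metis
    then show "u = v" using K(5)[OF uv(1,2)] by blast
  qed
  then show ?thesis by blast
qed

lemma pullback_split_epi:
  assumes pb: "is_pullback C P p' f' Z' Y p f Z" and p: "split_epi C Y p Z"
  shows "split_epi C P p' Z'"
proof -
  note P = pullbackD[OF pb]
  note Z' = hom_obj1[OF P(4)]
  obtain X i s where k: "is_kernel C X i Y p Z" and s: "s \<in> Hom C Z Y" "p \<cdot> s = Ide C Z"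
    using p by (rule split_epiE)
  obtain i' where i': "is_kernel C X i' P p' Z'" using pullback_kernel[OF pb k] by blast
  have "f \<cdot> Ide C Z' = p \<cdot> (s \<cdot> f)"
    using comp_assoc[OF P(4) s(1) P(3)] s(2) comp_ide_left[OF P(4)] comp_ide_right[OF P(4)] by metis
  then obtain s' where "s' \<in> Hom C Z' P" "p' \<cdot> s' = Ide C Z'"
    using P(6)[OF ide_hom[OF Z'] comp_hom[OF P(4) s(1)]] by blast
  then show ?thesis by (rule split_epiI[OF i'])
qed

text \<open>
  A map \<open>t\<close> is killed by \<open>q p\<close> if and only if \<open>p t\<close> factors through the kernel of \<open>q\<close>, so the kernel
  of \<open>q p\<close> is the preimage of that of \<open>q\<close>.
\<close>

lemma kernel_comp:
  assumes pb: "is_pullback C P p' f' L X p j Y" and k: "is_kernel C L j Y q Z"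
  shows "is_kernel C P f' X (q \<cdot> p) Z"
proof (rule kernelI)
  note P = pullbackD[OF pb] and K = kernelD[OF k]
  show "f' \<in> Hom C P X" by (fact P(2))
  show "q \<cdot> p \<in> Hom C X Z" using comp_hom[OF P(3) K(2)] .
  have "(q \<cdot> p) \<cdot> f' = (q \<cdot> j) \<cdot> p'"
    using comp_assoc[OF P(2,3) K(2)] comp_assoc[OF P(1) K(1,2)] P(5) by metis
  then show "(q \<cdot> p) \<cdot> f' = Zero C P Z"
    using K(3) comp_zero_left[OF P(1) hom_obj2[OF K(2)]] by simp
next
  note P = pullbackD[OF pb] and K = kernelD[OF k]
  fix t T assume t: "t \<in> Hom C T X" "(q \<cdot> p) \<cdot> t = Zero C T Z"
  then have "q \<cdot> (p \<cdot> t) = Zero C T Z" using comp_assoc[OF t(1) P(3) K(2)] by metis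
  then obtain v where v: "v \<in> Hom C T L" "j \<cdot> v = p \<cdot> t"
    using K(4)[OF comp_hom[OF t(1) P(3)]] by blast
  then show "\<exists>u \<in> Hom C T P. f' \<cdot> u = t" using P(6)[OF v(1) t(1)] by blast
next
  note P = pullbackD[OF pb] and K = kernelD[OF k]
  fix u v T assume uv: "u \<in> Hom C T P" "v \<in> Hom C T P" "f' \<cdot> u = f' \<cdot> v"
  have "j \<cdot> (p' \<cdot> u) = j \<cdot> (p' \<cdot> v)"
    using comp_assoc[OF uv(1) P(1,4)] comp_assoc[OF uv(2) P(1,4)] comp_assoc[OF uv(1) P(2,3)]
      comp_assoc[OF uv(2) P(2,3)] P(5) uv(3) by metis
  then have "p' \<cdot> u = p' \<cdot> v" using K(5)[OF comp_hom[OF uv(1) P(1)] comp_hom[OF uv(2) P(1)]] by blast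
  then show "u = v" using P(7)[OF uv(1,2)] uv(3) by blast
qed

text \<open>
  Isomorphisms carry over the kernel property of \<open>i\<close> and the existence of a section of \<open>p\<close>, and these
  two make up a biproduct.
\<close>

lemma biproduct_isomorphic:
  assumes b: "is_biproduct C X Z Y i s r p"
    and iso: "isomorphic_seqs C (X, i, Y, p, Z) (X', i', Y', p', Z')"
  shows "\<exists>s' r'. is_biproduct C X' Z' Y' i' s' r' p'"
proof -
  note B = biproductD[OF b] and K = kernelD[OF biproduct_kernel[OF b]]
  obtain a a' b b' c c' where
    h: "i' \<in> Hom C X' Y'" "p' \<in> Hom C Y' Z'" "a \<in> Hom C X X'" "a' \<in> Hom C X' X"
    "b \<in> Hom C Y Y'" "b' \<in> Hom C Y' Y" "c \<in> Hom C Z Z'" "c' \<in> Hom C Z' Z" and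
    inv: "a \<cdot> a' = Ide C X'" "b' \<cdot> b = Ide C Y" "b \<cdot> b' = Ide C Y'"
    "c' \<cdot> c = Ide C Z" "c \<cdot> c' = Ide C Z'" and
    sq: "b \<cdot> i = i' \<cdot> a" "c \<cdot> p = p' \<cdot> b"
    using iso by (auto simp: iso_arrow_def)
  have p': "p' = (c \<cdot> p) \<cdot> b'"
    using comp_assoc[OF h(6,5,2)] sq(2) inv(3) comp_ide_right[OF h(2)] by metis
  have i': "i' = (b \<cdot> i) \<cdot> a'"
    using comp_assoc[OF h(4,3,1)] sq(1) inv(1) comp_ide_right[OF h(1)] by metis
  have b'i': "b' \<cdot> i' = i \<cdot> a'"
  proof -
    have "b' \<cdot> ((b \<cdot> i) \<cdot> a') = (b' \<cdot> b) \<cdot> (i \<cdot> a')"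
      using comp_assoc[OF h(4) B(1) h(5)] comp_assoc[OF comp_hom[OF h(4) B(1)] h(5,6)] by simp
    then show ?thesis using i' inv(2) comp_ide_left[OF comp_hom[OF h(4) B(1)]] by simp
  qed
  have pb': "p \<cdot> b' = c' \<cdot> p'"
  proof -
    have "c' \<cdot> ((c \<cdot> p) \<cdot> b') = (c' \<cdot> c) \<cdot> (p \<cdot> b')"
      using comp_assoc[OF h(6) B(4) h(7)] comp_assoc[OF comp_hom[OF h(6) B(4)] h(7,8)] by simp
    then show ?thesis using p' inv(4) comp_ide_left[OF comp_hom[OF h(6) B(4)]] by simp
  qed
  have "is_kernel C X' i' Y' p' Z'"
  proof (rule kernelI[OF h(1,2)])
    have "p' \<cdot> i' = c \<cdot> ((p \<cdot> b') \<cdot> i')"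
      using comp_assoc[OF h(6) B(4) h(7)] comp_assoc[OF h(1) comp_hom[OF h(6) B(4)] h(7)] p' by simp
    also have "(p \<cdot> b') \<cdot> i' = (p \<cdot> i) \<cdot> a'"
      using comp_assoc[OF h(1,6) B(4)] comp_assoc[OF h(4) B(1,4)] b'i' by simp
    finally show "p' \<cdot> i' = Zero C X' Z'"
      using B(8) comp_zero_left[OF h(4) B(11)] comp_zero_right[OF h(7) hom_obj1[OF h(4)]] by simp
  next
    fix t T assume t: "t \<in> Hom C T Y'" "p' \<cdot> t = Zero C T Z'"
    have "p \<cdot> (b' \<cdot> t) = c' \<cdot> (p' \<cdot> t)"
      using comp_assoc[OF t(1) h(6) B(4)] comp_assoc[OF t(1) h(2,8)] pb' by simp
    then have "p \<cdot> (b' \<cdot> t) = Zero C T Z"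
      using t(2) comp_zero_right[OF h(8) hom_obj1[OF t(1)]] by simp
    then obtain u where u: "u \<in> Hom C T X" "i \<cdot> u = b' \<cdot> t"
      using K(4)[OF comp_hom[OF t(1) h(6)]] by blast
    have "i' \<cdot> (a \<cdot> u) = b \<cdot> (i \<cdot> u)"
      using comp_assoc[OF u(1) h(3,1)] comp_assoc[OF u(1) B(1) h(5)] sq(1) by simp
    also have "\<dots> = t" using u(2) comp_assoc[OF t(1) h(6,5)] inv(3) comp_ide_left[OF t(1)] by simp
    finally show "\<exists>u \<in> Hom C T X'. i' \<cdot> u = t" using comp_hom[OF u(1) h(3)] by blast
  next
    fix u v T assume uv: "u \<in> Hom C T X'" "v \<in> Hom C T X'" "i' \<cdot> u = i' \<cdot> v"
    have move: "i \<cdot> (a' \<cdot> w) = b' \<cdot> (i' \<cdot> w)" "a \<cdot> (a' \<cdot> w) = w" if "w \<in> Hom C T X'" for w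
      using comp_assoc[OF that h(4) B(1)] comp_assoc[OF that h(1,6)] b'i'
        comp_assoc[OF that h(4,3)] inv(1) comp_ide_left[OF that] by simp_all
    have "a' \<cdot> u = a' \<cdot> v"
      using K(5)[OF comp_hom[OF uv(1) h(4)] comp_hom[OF uv(2) h(4)]] move(1) uv by simp
    then show "u = v" using move(2) uv by metis
  qed
  moreover have "b \<cdot> (s \<cdot> c') \<in> Hom C Z' Y'"
    using comp_hom[OF comp_hom[OF h(8) B(2)] h(5)] .
  moreover have "p' \<cdot> (b \<cdot> (s \<cdot> c')) = Ide C Z'"
  proof -
    have "p' \<cdot> (b \<cdot> (s \<cdot> c')) = (c \<cdot> p) \<cdot> (s \<cdot> c')"
      using comp_assoc[OF comp_hom[OF h(8) B(2)] h(5,2)] sq(2) by simp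
    also have "\<dots> = c \<cdot> ((p \<cdot> s) \<cdot> c')"
      using comp_assoc[OF comp_hom[OF h(8) B(2)] B(4) h(7)] comp_assoc[OF h(8) B(2,4)] by simp
    finally show ?thesis using B(6) comp_ide_left[OF h(8)] inv(5) by simp
  qed
  ultimately show ?thesis using biproduct_of_kernel_section by blast
qed

lemma isomorphic_seqs_sym:
  assumes "isomorphic_seqs C (X, i, Y, p, Z) (U, j, D, q, V)"
  shows "isomorphic_seqs C (U, j, D, q, V) (X, i, Y, p, Z)"
proof -
  obtain a a' b b' c c' where
    h: "i \<in> Hom C X Y" "p \<in> Hom C Y Z" "j \<in> Hom C U D" "q \<in> Hom C D V"
    "a \<in> Hom C X U" "a' \<in> Hom C U X" "b \<in> Hom C Y D" "b' \<in> Hom C D Y"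
    "c \<in> Hom C Z V" "c' \<in> Hom C V Z" and
    inv: "a' \<cdot> a = Ide C X" "a \<cdot> a' = Ide C U" "b' \<cdot> b = Ide C Y" "b \<cdot> b' = Ide C D"
    "c' \<cdot> c = Ide C Z" "c \<cdot> c' = Ide C V" and
    sq: "b \<cdot> i = j \<cdot> a" "c \<cdot> p = q \<cdot> b"
    using assms by (auto simp: iso_arrow_def)
  have "b' \<cdot> j = (b' \<cdot> (j \<cdot> a)) \<cdot> a'"
    using comp_assoc[OF h(6) comp_hom[OF h(5,3)] h(8)] comp_assoc[OF h(6,5,3)] inv(2)
      comp_ide_right[OF h(3)] by simp
  also have "b' \<cdot> (j \<cdot> a) = i"
    using sq(1) comp_assoc[OF h(1,7,8)] inv(3) comp_ide_left[OF h(1)] by metis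
  finally have 1: "b' \<cdot> j = i \<cdot> a'" .
  have "p \<cdot> b' = c' \<cdot> ((c \<cdot> p) \<cdot> b')"
    using comp_assoc[OF h(8,2,9)] comp_assoc[OF comp_hom[OF h(8,2)] h(9,10)] inv(5)
      comp_ide_left[OF comp_hom[OF h(8,2)]] by simp
  also have "(c \<cdot> p) \<cdot> b' = q"
    using sq(2) comp_assoc[OF h(8,7,4)] inv(4) comp_ide_right[OF h(4)] by metis
  finally have 2: "c' \<cdot> q = p \<cdot> b'" by simp
  have "iso_arrow C U X a'" "iso_arrow C D Y b'" "iso_arrow C V Z c'"
    unfolding iso_arrow_def using h inv by blast+
  with 1 2 h show ?thesis by auto
qed

lemma split_seq_iff:
  "is_split_seq C (X, i, Y, p, Z) \<longleftrightarrow> (\<exists>s r. is_biproduct C X Z Y i s r p)"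
proof
  assume "is_split_seq C (X, i, Y, p, Z)"
  then obtain U V D iU iV pU pV where
    b: "is_biproduct C U V D iU iV pU pV"
    and iso: "isomorphic_seqs C (X, i, Y, p, Z) (U, iU, D, pV, V)"
    unfolding is_split_seq_def by blast
  have "isomorphic_seqs C (U, iU, D, pV, V) (X, i, Y, p, Z)"
    using iso by (rule isomorphic_seqs_sym)
  then show "\<exists>s r. is_biproduct C X Z Y i s r p" by (rule biproduct_isomorphic[OF b])
next
  assume "\<exists>s r. is_biproduct C X Z Y i s r p"
  then obtain s r where b: "is_biproduct C X Z Y i s r p" by blast
  note B = biproductD[OF b]
  have "iso_arrow C W W (Ide C W)" if "W \<in> Obj C" for W
    using ide_hom[OF that] comp_ide_left unfolding iso_arrow_def by blast
  then have "isomorphic_seqs C (X, i, Y, p, Z) (X, i, Y, p, Z)"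
    using B comp_ide_left comp_ide_right by (auto intro!: exI[of _ "Ide C _"])
  then show "is_split_seq C (X, i, Y, p, Z)" using b B unfolding is_split_seq_def by blast
qed

end

context additive_category
begin

text \<open>
  If \<open>Y = X \<oplus> Z\<close> with projection \<open>p\<close> to \<open>Z\<close>, then the pullback of \<open>p\<close> along \<open>f : Z' \<rightarrow> Z\<close> is
  \<open>X \<oplus> Z'\<close>, mapped to \<open>Y\<close> by \<open>1 \<oplus> f\<close>.
\<close>

lemma ex_pullback_split_epi:
  assumes p: "split_epi C Y p Z" and f: "f \<in> Hom C Z' Z"
  shows "\<exists>P p' f'. is_pullback C P p' f' Z' Y p f Z"
proof -
  obtain X i s r where b: "is_biproduct C X Z Y i s r p"
    using p unfolding split_epi_def by blast
  note B = biproductD[OF b]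
  obtain P j1 j2 q1 q2 where b': "is_biproduct C X Z' P j1 j2 q1 q2"
    using ex_biproduct[OF B(10) hom_obj1[OF f]] by blast
  note B' = biproductD[OF b']
  obtain f' where f': "f' \<in> Hom C P Y" "r \<cdot> f' = q1" "p \<cdot> f' = f \<cdot> q2"
    using biproduct_pairing[OF b B'(3) comp_hom[OF B'(4) f]] by blast
  have "is_pullback C P q2 f' Z' Y p f Z"
  proof (rule pullbackI[OF B'(4) f'(1) B(4) f f'(3)[symmetric]])
    fix a b T assume ab: "a \<in> Hom C T Z'" "b \<in> Hom C T Y" "f \<cdot> a = p \<cdot> b"
    obtain u where u: "u \<in> Hom C T P" "q1 \<cdot> u = r \<cdot> b" "q2 \<cdot> u = a"
      using biproduct_pairing[OF b' comp_hom[OF ab(2) B(3)] ab(1)] by blast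
    have "r \<cdot> (f' \<cdot> u) = r \<cdot> b" using comp_assoc[OF u(1) f'(1) B(3)] f'(2) u(2) by simp
    moreover have "p \<cdot> (f' \<cdot> u) = p \<cdot> b"
      using comp_assoc[OF u(1) f'(1) B(4)] comp_assoc[OF u(1) B'(4) f] f'(3) u(3) ab(3) by simp
    ultimately have "f' \<cdot> u = b"
      using biproduct_jointly_monic[OF b comp_hom[OF u(1) f'(1)] ab(2)] by blast
    then show "\<exists>u \<in> Hom C T P. q2 \<cdot> u = a \<and> f' \<cdot> u = b" using u by blast
  next
    fix u v T
    assume uv: "u \<in> Hom C T P" "v \<in> Hom C T P" "q2 \<cdot> u = q2 \<cdot> v" "f' \<cdot> u = f' \<cdot> v"
    have "q1 \<cdot> u = q1 \<cdot> v"
      using comp_assoc[OF uv(1) f'(1) B(3)] comp_assoc[OF uv(2) f'(1) B(3)] f'(2) uv(4) by simp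
    then show "u = v" using biproduct_jointly_monic[OF b' uv(1,2)] uv(3) by blast
  qed
  then show ?thesis by blast
qed

lemma split_epi_comp:
  assumes p: "split_epi C X p Y" and q: "split_epi C Y q Z"
  shows "split_epi C X (q \<cdot> p) Z"
proof -
  obtain K k s where k: "is_kernel C K k X p Y" and s: "s \<in> Hom C Y X" "p \<cdot> s = Ide C Y"
    using p by (rule split_epiE)
  obtain L j t where j: "is_kernel C L j Y q Z" and t: "t \<in> Hom C Z Y" "q \<cdot> t = Ide C Z"
    using q by (rule split_epiE)
  note h = kernelD(2)[OF k] kernelD(2)[OF j]
  obtain P p' f' where "is_pullback C P p' f' L X p j Y"
    using ex_pullback_split_epi[OF p kernelD(1)[OF j]] by blast
  then have "is_kernel C P f' X (q \<cdot> p) Z" using kernel_comp j by blast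
  moreover have "s \<cdot> t \<in> Hom C Z X" using comp_hom[OF t(1) s(1)] .
  moreover have "(q \<cdot> p) \<cdot> (s \<cdot> t) = Ide C Z"
  proof -
    have "p \<cdot> (s \<cdot> t) = t" using comp_assoc[OF t(1) s(1) h(1)] s(2) comp_ide_left[OF t(1)] by simp
    then show ?thesis using comp_assoc[OF comp_hom[OF t(1) s(1)] h] t(2) by simp
  qed
  ultimately show ?thesis by (rule split_epiI)
qed

end


section \<open>Biproducts of finite families\<close>

definition is_coproduct ::
  "('o, 'm, 'e) preadditive_scheme \<Rightarrow> 'i set \<Rightarrow> ('i \<Rightarrow> 'o) \<Rightarrow> 'o \<Rightarrow> ('i \<Rightarrow> 'm) \<Rightarrow> bool" where
  "is_coproduct C I V D \<iota> \<longleftrightarrow> D \<in> Obj C \<and> (\<forall>n \<in> I. \<iota> n \<in> Hom C (V n) D) \<and>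
     (\<forall>T \<in> Obj C. \<forall>g. (\<forall>n \<in> I. g n \<in> Hom C (V n) T) \<longrightarrow>
       (\<exists>!u. u \<in> Hom C D T \<and> (\<forall>n \<in> I. u \<cdot>\<^bsub>C\<^esub> \<iota> n = g n)))"

text \<open>
  The family \<open>V\<close> is defined on the whole index type, and the summands are those with index in \<open>I\<close>.
  The inclusions and projections at the other indices are forced to be zero. With
  this convention the differential of a free complex needs no case distinction at the end of
  a string. Expressing products as coproducts in the opposite category makes the notion self-dual
  on its face.
\<close>

definition is_family_biproduct ::
  "('o, 'm, 'e) preadditive_scheme \<Rightarrow> 'i set \<Rightarrow> ('i \<Rightarrow> 'o) \<Rightarrow> 'o \<Rightarrow> ('i \<Rightarrow> 'm) \<Rightarrow> ('i \<Rightarrow> 'm) \<Rightarrow> bool"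
  where
  "is_family_biproduct C I V D \<iota> \<pi> \<longleftrightarrow>
     (\<forall>n. V n \<in> Obj C \<and> \<iota> n \<in> Hom C (V n) D \<and> \<pi> n \<in> Hom C D (V n)) \<and>
     (\<forall>m n. \<pi> m \<cdot>\<^bsub>C\<^esub> \<iota> n = (if m = n \<and> n \<in> I then Ide C (V n) else Zero C (V n) (V m))) \<and>
     is_coproduct C I V D \<iota> \<and> is_coproduct (opposite C) I V D \<pi>"

lemma opposite_family_biproduct:
  "is_family_biproduct C I V D \<iota> \<pi> \<Longrightarrow> is_family_biproduct (opposite C) I V D \<pi> \<iota>"
  by (auto simp: is_family_biproduct_def is_coproduct_def)

context preadditive_category
begin

lemma coproductD:
  assumes "is_coproduct C I V D \<iota>"
  shows "D \<in> Obj C" "n \<in> I \<Longrightarrow> \<iota> n \<in> Hom C (V n) D"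
    "T \<in> Obj C \<Longrightarrow> (\<And>n. n \<in> I \<Longrightarrow> g n \<in> Hom C (V n) T) \<Longrightarrow>
      \<exists>u \<in> Hom C D T. \<forall>n \<in> I. u \<cdot> \<iota> n = g n"
    "u \<in> Hom C D T \<Longrightarrow> v \<in> Hom C D T \<Longrightarrow> (\<And>n. n \<in> I \<Longrightarrow> u \<cdot> \<iota> n = v \<cdot> \<iota> n) \<Longrightarrow> u = v"
proof -
  show D: "D \<in> Obj C" and \<iota>: "\<And>n. n \<in> I \<Longrightarrow> \<iota> n \<in> Hom C (V n) D"
    using assms by (auto simp: is_coproduct_def)
  have univ: "\<exists>!u. u \<in> Hom C D T \<and> (\<forall>n \<in> I. u \<cdot> \<iota> n = g n)"
    if "T \<in> Obj C" "\<And>n. n \<in> I \<Longrightarrow> g n \<in> Hom C (V n) T" for T g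
    using assms that by (simp add: is_coproduct_def)
  then show "T \<in> Obj C \<Longrightarrow> (\<And>n. n \<in> I \<Longrightarrow> g n \<in> Hom C (V n) T) \<Longrightarrow>
      \<exists>u \<in> Hom C D T. \<forall>n \<in> I. u \<cdot> \<iota> n = g n"
    by blast
  assume u: "u \<in> Hom C D T" "v \<in> Hom C D T" "\<And>n. n \<in> I \<Longrightarrow> u \<cdot> \<iota> n = v \<cdot> \<iota> n"
  have "\<exists>!w. w \<in> Hom C D T \<and> (\<forall>n \<in> I. w \<cdot> \<iota> n = u \<cdot> \<iota> n)"
    by (rule univ[OF hom_obj2[OF u(1)]]) (rule comp_hom[OF \<iota> u(1)])
  then show "u = v" using u by metis
qed

lemma coproduct_insert:
  assumes b: "is_biproduct C (V x) D E i j p q" and c: "is_coproduct C I V D \<iota>" and x: "x \<notin> I"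
  shows "is_coproduct C (insert x I) V E (\<lambda>n. if n = x then i else j \<cdot> \<iota> n)"
proof -
  note B = biproductD[OF b] and K = coproductD[OF c]
  have ne: "n \<noteq> x" if "n \<in> I" for n using that x by blast
  have "\<exists>!u. u \<in> Hom C E T \<and> (\<forall>n \<in> insert x I. u \<cdot> (if n = x then i else j \<cdot> \<iota> n) = g n)"
    if T: "T \<in> Obj C" and g: "\<forall>n \<in> insert x I. g n \<in> Hom C (V n) T" for T g
  proof -
    have gx: "g x \<in> Hom C (V x) T" using g by simp
    obtain u' where u': "u' \<in> Hom C D T" "\<And>n. n \<in> I \<Longrightarrow> u' \<cdot> \<iota> n = g n"
      using K(3)[OF T, of g] g by auto
    obtain u where u: "u \<in> Hom C E T" "u \<cdot> i = g x" "u \<cdot> j = u'"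
      using biproduct_copairing[OF b gx u'(1)] by blast
    show ?thesis
    proof (rule ex1I[of _ u])
      show "u \<in> Hom C E T \<and> (\<forall>n \<in> insert x I. u \<cdot> (if n = x then i else j \<cdot> \<iota> n) = g n)"
        using u u'(2) ne comp_assoc[OF K(2) B(2) u(1)] by auto
      fix v assume v: "v \<in> Hom C E T \<and> (\<forall>n \<in> insert x I. v \<cdot> (if n = x then i else j \<cdot> \<iota> n) = g n)"
      have vE: "v \<in> Hom C E T" using v by blast
      have "v \<cdot> j = u'"
      proof (rule K(4)[OF comp_hom[OF B(2) vE] u'(1)])
        fix n assume n: "n \<in> I"
        have "(v \<cdot> j) \<cdot> \<iota> n = v \<cdot> (j \<cdot> \<iota> n)" by (rule comp_assoc[OF K(2)[OF n] B(2) vE])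
        then show "(v \<cdot> j) \<cdot> \<iota> n = u' \<cdot> \<iota> n" using v n ne[OF n] u'(2)[OF n] by auto
      qed
      moreover have "v \<cdot> i = g x" using v by simp
      ultimately show "v = u" using biproduct_jointly_epic[OF b vE u(1)] u by simp
    qed
  qed
  moreover have "j \<cdot> \<iota> n \<in> Hom C (V n) E" if "n \<in> I" for n
    using comp_hom[OF K(2)[OF that] B(2)] .
  ultimately show ?thesis unfolding is_coproduct_def using B(1,12) by simp
qed

lemma family_biproductD:
  assumes "is_family_biproduct C I V D \<iota> \<pi>"
  shows "V n \<in> Obj C" "\<iota> n \<in> Hom C (V n) D" "\<pi> n \<in> Hom C D (V n)"
    "n \<in> I \<Longrightarrow> \<pi> n \<cdot> \<iota> n = Ide C (V n)"
    "n \<notin> I \<or> m \<noteq> n \<Longrightarrow> \<pi> m \<cdot> \<iota> n = Zero C (V n) (V m)"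
    "is_coproduct C I V D \<iota>" "is_coproduct (opposite C) I V D \<pi>"
  using assms unfolding is_family_biproduct_def by auto

lemma family_jointly_epic:
  assumes "is_family_biproduct C I V D \<iota> \<pi>" "u \<in> Hom C D T" "v \<in> Hom C D T"
    "\<And>n. n \<in> I \<Longrightarrow> u \<cdot> \<iota> n = v \<cdot> \<iota> n"
  shows "u = v"
  using coproductD(4)[OF family_biproductD(6)[OF assms(1)] assms(2,3)] assms(4) by blast

lemma family_jointly_monic:
  assumes "is_family_biproduct C I V D \<iota> \<pi>" "u \<in> Hom C T D" "v \<in> Hom C T D"
    "\<And>n. n \<in> I \<Longrightarrow> \<pi> n \<cdot> u = \<pi> n \<cdot> v"
  shows "u = v"
  using preadditive_category.family_jointly_epic[OF opposite_preadditive
      opposite_family_biproduct[OF assms(1)], of u T v] assms by simp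

lemma family_inclusion_zero:
  assumes b: "is_family_biproduct C I V D \<iota> \<pi>" and n: "n \<notin> I"
  shows "\<iota> n = Zero C (V n) D"
proof (rule family_jointly_monic[OF b])
  note B = family_biproductD[OF b]
  show "\<iota> n \<in> Hom C (V n) D" by (rule B(2))
  show "Zero C (V n) D \<in> Hom C (V n) D" using zero_hom[OF B(1) hom_obj2[OF B(2)]] .
  show "\<pi> m \<cdot> \<iota> n = \<pi> m \<cdot> Zero C (V n) D" for m
    using B(5)[of n m] n comp_zero_right[OF B(3)[of m] B(1)[of n]] by simp
qed

text \<open>
  The complement of the summand \<open>V x\<close> is the biproduct \<open>R\<close> of the others, embedded by
  \<open>\<iota> n - \<iota> x p \<iota> n\<close> on \<open>V n\<close> so as to land in the kernel of \<open>p\<close>. For \<open>x\<close> outside \<open>I\<close> the hypothesis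
  on \<open>p\<close> makes \<open>V x\<close> a zero object, and the same formulas apply.
\<close>

lemma split_epi_of_summand:
  assumes b: "is_family_biproduct C I V D \<iota> \<pi>" and r: "is_family_biproduct C (I - {x}) V R \<rho> \<sigma>"
    and p: "p \<in> Hom C D (V x)" "p \<cdot> \<iota> x = Ide C (V x)"
  shows "split_epi C D p (V x)"
proof -
  note B = family_biproductD[OF b] and R = family_biproductD[OF r]
  note K = coproductD[OF B(6)] and L = coproductD[OF R(6)]
  have "\<exists>k. k \<in> Hom C (V n) D \<and> p \<cdot> k = Zero C (V n) (V x) \<and> k \<boxplus> \<iota> x \<cdot> (p \<cdot> \<iota> n) = \<iota> n" for n
  proof -
    have h: "p \<cdot> \<iota> n \<in> Hom C (V n) (V x)" using comp_hom[OF B(2) p(1)] .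
    have h': "\<iota> x \<cdot> (p \<cdot> \<iota> n) \<in> Hom C (V n) D" using comp_hom[OF h B(2)] .
    obtain m where m: "m \<in> Hom C (V n) D" "m \<boxplus> \<iota> x \<cdot> (p \<cdot> \<iota> n) = Zero C (V n) D"
      using ex_neg[OF h'] by blast
    have "p \<cdot> (\<iota> n \<boxplus> m) = p \<cdot> (m \<boxplus> \<iota> n)" using add_comm[OF B(2) m(1)] by simp
    also have "\<dots> = p \<cdot> m \<boxplus> p \<cdot> \<iota> n" by (rule comp_add_right[OF m(1) B(2) p(1)])
    also have "p \<cdot> \<iota> n = p \<cdot> (\<iota> x \<cdot> (p \<cdot> \<iota> n))"
      using comp_assoc[OF h B(2) p(1)] p(2) comp_ide_left[OF h] by simp
    also have "p \<cdot> m \<boxplus> p \<cdot> (\<iota> x \<cdot> (p \<cdot> \<iota> n)) = Zero C (V n) (V x)"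
      using comp_add_right[OF m(1) h' p(1)] m(2) comp_zero_right[OF p(1) B(1)] by simp
    finally have "p \<cdot> (\<iota> n \<boxplus> m) = Zero C (V n) (V x)" .
    moreover have "(\<iota> n \<boxplus> m) \<boxplus> \<iota> x \<cdot> (p \<cdot> \<iota> n) = \<iota> n"
      using add_assoc[OF B(2) m(1) h'] m(2) add_zero_right[OF B(2)] by simp
    ultimately show ?thesis using add_hom[OF B(2) m(1)] by blast
  qed
  then obtain c where c: "\<And>n. c n \<in> Hom C (V n) D" "\<And>n. p \<cdot> c n = Zero C (V n) (V x)"
    "\<And>n. c n \<boxplus> \<iota> x \<cdot> (p \<cdot> \<iota> n) = \<iota> n"
    by metis
  obtain k where k: "k \<in> Hom C R D" "\<And>n. n \<in> I - {x} \<Longrightarrow> k \<cdot> \<rho> n = c n"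
    using L(3)[of D c] K(1) c(1) by blast
  obtain q where q: "q \<in> Hom C D R" and "\<forall>n \<in> I. q \<cdot> \<iota> n = (if n = x then Zero C (V x) R else \<rho> n)"
    using K(3)[OF L(1), of "\<lambda>n. if n = x then Zero C (V x) R else \<rho> n"] R(2)
      zero_hom[OF B(1)[of x] L(1)] by (metis (no_types, lifting))
  then have q\<iota>: "q \<cdot> \<iota> n = \<rho> n" if "n \<in> I - {x}" for n using that by simp
  have q\<iota>x: "q \<cdot> \<iota> x = Zero C (V x) R"
  proof (cases "x \<in> I")
    case True
    then show ?thesis using \<open>\<forall>n \<in> I. _ n\<close> by simp
  next
    case False
    then show ?thesis using family_inclusion_zero[OF b] comp_zero_right[OF q B(1)] by simp
  qed
  have "p \<cdot> k = Zero C R (V x)"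
  proof (rule family_jointly_epic[OF r comp_hom[OF k(1) p(1)] zero_hom[OF L(1) B(1)]])
    fix n assume n: "n \<in> I - {x}"
    show "(p \<cdot> k) \<cdot> \<rho> n = Zero C R (V x) \<cdot> \<rho> n"
      using comp_assoc[OF R(2) k(1) p(1)] k(2)[OF n] c(2) comp_zero_left[OF R(2) B(1)] by simp
  qed
  moreover have "q \<cdot> k = Ide C R"
  proof (rule family_jointly_epic[OF r comp_hom[OF k(1) q] ide_hom[OF L(1)]])
    fix n assume n: "n \<in> I - {x}"
    have h: "p \<cdot> \<iota> n \<in> Hom C (V n) (V x)" using comp_hom[OF B(2) p(1)] .
    have "\<rho> n = q \<cdot> c n \<boxplus> q \<cdot> (\<iota> x \<cdot> (p \<cdot> \<iota> n))"
      using comp_add_right[OF c(1) comp_hom[OF h B(2)] q] c(3) q\<iota>[OF n] by simp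
    also have "q \<cdot> (\<iota> x \<cdot> (p \<cdot> \<iota> n)) = Zero C (V n) R"
      using comp_assoc[OF h B(2) q] q\<iota>x comp_zero_left[OF h L(1)] by simp
    finally have "q \<cdot> c n = \<rho> n" using add_zero_right[OF comp_hom[OF c(1) q]] by simp
    then show "(q \<cdot> k) \<cdot> \<rho> n = Ide C R \<cdot> \<rho> n"
      using comp_assoc[OF R(2) k(1) q] k(2)[OF n] comp_ide_left[OF R(2)] by simp
  qed
  moreover have "k \<cdot> q \<boxplus> \<iota> x \<cdot> p = Ide C D"
  proof -
    have h: "k \<cdot> q \<in> Hom C D D" "\<iota> x \<cdot> p \<in> Hom C D D"
      using comp_hom[OF q k(1)] comp_hom[OF p(1) B(2)] by auto
    show ?thesis
    proof (rule family_jointly_epic[OF b add_hom[OF h] ide_hom[OF K(1)]])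
      fix n assume n: "n \<in> I"
      have "(k \<cdot> q \<boxplus> \<iota> x \<cdot> p) \<cdot> \<iota> n = k \<cdot> (q \<cdot> \<iota> n) \<boxplus> \<iota> x \<cdot> (p \<cdot> \<iota> n)"
        using comp_add_left[OF B(2) h] comp_assoc[OF B(2) q k(1)] comp_assoc[OF B(2) p(1) B(2)] by simp
      also have "\<dots> = \<iota> n"
      proof (cases "n = x")
        case True
        then show ?thesis
          using q\<iota>x comp_zero_right[OF k(1) B(1)] p(2) comp_ide_right[OF B(2)] add_zero_left[OF B(2)]
          by simp
      next
        case False
        then show ?thesis using q\<iota> k(2) n c(3) by simp
      qed
      finally show "(k \<cdot> q \<boxplus> \<iota> x \<cdot> p) \<cdot> \<iota> n = Ide C D \<cdot> \<iota> n" using comp_ide_left[OF B(2)] by simp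
    qed
  qed
  ultimately have "is_biproduct C R (V x) D k (\<iota> x) q p"
    unfolding is_biproduct_def using k(1) B(2) q p q\<iota>x by simp
  then show ?thesis unfolding split_epi_def by blast
qed

end

lemma (in additive_category) ex_family_biproduct:
  assumes I: "finite I" and V: "\<And>n. V n \<in> Obj C"
  shows "\<exists>D \<iota> \<pi>. is_family_biproduct C I V D \<iota> \<pi>"
  using I
proof (induction I rule: finite_induct)
  case empty
  obtain Z where zero: "zero_object C Z" using ex_zero_object ..
  then have Z: "Z \<in> Obj C" by (simp add: zero_object_def)
  have "is_coproduct C {} V Z (\<lambda>n. Zero C (V n) Z)"
    "is_coproduct (opposite C) {} V Z (\<lambda>n. Zero C Z (V n))"
    using zero by (simp_all add: zero_object_def is_coproduct_def)
  then have "is_family_biproduct C {} V Z (\<lambda>n. Zero C (V n) Z) (\<lambda>n. Zero C Z (V n))"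
    unfolding is_family_biproduct_def
    using V zero_hom Z comp_zero_left[OF zero_hom[OF V Z] V] by simp
  then show ?case by blast
next
  case (insert x I)
  then obtain D \<iota> \<pi> where d: "is_family_biproduct C I V D \<iota> \<pi>" by blast
  note F = family_biproductD[OF d]
  obtain E i j p q where b: "is_biproduct C (V x) D E i j p q"
    using ex_biproduct[OF V[of x] coproductD(1)[OF F(6)]] by blast
  note B = biproductD[OF b]
  define \<iota>' where "\<iota>' = (\<lambda>n. if n = x then i else j \<cdot> \<iota> n)"
  define \<pi>' where "\<pi>' = (\<lambda>n. if n = x then p else \<pi> n \<cdot> q)"
  have "is_coproduct C (insert x I) V E \<iota>'"
    unfolding \<iota>'_def by (rule coproduct_insert[OF b F(6) insert(2)])
  moreover have "is_coproduct (opposite C) (insert x I) V E \<pi>'"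
    using preadditive_category.coproduct_insert[OF opposite_preadditive
        opposite_biproduct[OF biproduct_swap[OF b]] F(7) insert(2)] 
    by (simp add: \<pi>'_def cong: if_cong)
  moreover have "\<iota>' n \<in> Hom C (V n) E" "\<pi>' n \<in> Hom C E (V n)" for n
    unfolding \<iota>'_def \<pi>'_def using B(1,3) comp_hom[OF F(2) B(2)] comp_hom[OF B(4) F(3)] by auto
  moreover have "\<pi>' m \<cdot> \<iota>' n = (if m = n \<and> n \<in> insert x I then Ide C (V n) else Zero C (V n) (V m))"
    for m n
  proof -
    have "p \<cdot> (j \<cdot> \<iota> n) = Zero C (V n) (V x)"
      using comp_assoc[OF F(2) B(2,3)] B(7) comp_zero_left[OF F(2) V] by simp
    moreover have "(\<pi> m \<cdot> q) \<cdot> i = Zero C (V x) (V m)"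
      using comp_assoc[OF B(1,4) F(3)] B(8) comp_zero_right[OF F(3) V] by simp
    moreover have "(\<pi> m \<cdot> q) \<cdot> (j \<cdot> \<iota> n) = \<pi> m \<cdot> \<iota> n"
      using comp_assoc[OF comp_hom[OF F(2) B(2)] B(4) F(3)] comp_assoc[OF F(2) B(2,4)] B(6)
        comp_ide_left[OF F(2)] by simp
    moreover have "\<pi> m \<cdot> \<iota> n = (if m = n \<and> n \<in> I then Ide C (V n) else Zero C (V n) (V m))"
      using F(4)[of n] F(5)[of n m] by auto
    ultimately show ?thesis using B(5) unfolding \<iota>'_def \<pi>'_def by auto
  qed
  ultimately have "is_family_biproduct C (insert x I) V E \<iota>' \<pi>'"
    unfolding is_family_biproduct_def using V by blast
  then show ?case by blast
qed


section \<open>The additive category of N-complexes\<close>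

definition is_diagram :: "('o, 'm, 'e) category_scheme \<Rightarrow> ('o, 'm) cplx \<Rightarrow> bool" where
  "is_diagram C X \<longleftrightarrow> (\<forall>n. ob X n \<in> Obj C \<and> diff X n \<in> Hom C (ob X n) (ob X (n + 1)))"

definition is_diagram_map ::
  "('o, 'm, 'e) category_scheme \<Rightarrow> ('o, 'm) cplx \<Rightarrow> ('o, 'm) cplx \<Rightarrow> (int \<Rightarrow> 'm) \<Rightarrow> bool" where
  "is_diagram_map C X Y f \<longleftrightarrow> (\<forall>n. f n \<in> Hom C (ob X n) (ob Y n)) \<and>
     (\<forall>n. f (n + 1) \<cdot>\<^bsub>C\<^esub> diff X n = diff Y n \<cdot>\<^bsub>C\<^esub> f n)"

lemma ncomplexes_simps [simp]:
  "Obj (ncomplexes N C) = {X. is_ncomplex N C X}"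
  "Ide (ncomplexes N C) X = (\<lambda>n. Ide C (ob X n))"
  "Comp (ncomplexes N C) g f = (\<lambda>n. g n \<cdot>\<^bsub>C\<^esub> f n)"
  "Add (ncomplexes N C) f g = (\<lambda>n. f n \<boxplus>\<^bsub>C\<^esub> g n)"
  "Zero (ncomplexes N C) X Y = (\<lambda>n. Zero C (ob X n) (ob Y n))"
  by (simp_all add: ncomplexes_def)

lemma ncomplexes_hom_iff:
  "f \<in> Hom (ncomplexes N C) X Y \<longleftrightarrow> is_ncomplex N C X \<and> is_ncomplex N C Y \<and> is_diagram_map C X Y f"
  by (simp add: ncomplexes_def ncomplex_hom_def is_diagram_map_def)

lemma ncomplexes_homD:
  assumes "f \<in> Hom (ncomplexes N C) X Y"
  shows "is_ncomplex N C X" "is_ncomplex N C Y" "is_diagram_map C X Y f"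
    "f n \<in> Hom C (ob X n) (ob Y n)" "f (n + 1) \<cdot>\<^bsub>C\<^esub> diff X n = diff Y n \<cdot>\<^bsub>C\<^esub> f n"
  using assms by (auto simp: ncomplexes_hom_iff is_diagram_map_def)

lemma ncomplexD:
  assumes "is_ncomplex N C X"
  shows "is_diagram C X" "ob X n \<in> Obj C" "diff X n \<in> Hom C (ob X n) (ob X (n + 1))"
    "diff_pow C X N n = Zero C (ob X n) (ob X (n + int N))"
  using assms by (auto simp: is_ncomplex_def is_diagram_def)

lemma is_ncomplex_iff:
  "is_ncomplex N C X \<longleftrightarrow>
    is_diagram C X \<and> (\<forall>n. diff_pow C X N n = Zero C (ob X n) (ob X (n + int N)))"
  by (auto simp: is_ncomplex_def is_diagram_def)

context preadditive_category
begin

lemma diff_pow_hom: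
  assumes "is_diagram C X"
  shows "diff_pow C X k n \<in> Hom C (ob X n) (ob X (n + int k))"
proof (induction k)
  case 0
  then show ?case using assms ide_hom by (simp add: is_diagram_def)
next
  case (Suc k)
  have "diff X (n + int k) \<in> Hom C (ob X (n + int k)) (ob X (n + int k + 1))"
    using assms by (simp add: is_diagram_def)
  from comp_hom[OF Suc this] show ?case by (simp add: ac_simps)
qed

lemma diff_pow_Suc_right:
  assumes X: "is_diagram C X"
  shows "diff_pow C X (Suc k) n = diff_pow C X k (n + 1) \<cdot> diff X n"
proof (induction k)
  case 0
  have "diff X n \<in> Hom C (ob X n) (ob X (n + 1))" using X by (simp add: is_diagram_def)
  then show ?case using comp_ide_left comp_ide_right by simp
next
  case (Suc k)
  have h: "diff X n \<in> Hom C (ob X n) (ob X (n + 1))"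
    "diff X (n + 1 + int k) \<in> Hom C (ob X (n + 1 + int k)) (ob X (n + 1 + int k + 1))"
    using X unfolding is_diagram_def by blast+
  have "diff_pow C X (Suc (Suc k)) n = diff X (n + 1 + int k) \<cdot> (diff_pow C X k (n + 1) \<cdot> diff X n)"
    unfolding Suc[symmetric] by (simp add: ac_simps)
  also have "\<dots> = diff_pow C X (Suc k) (n + 1) \<cdot> diff X n"
    using comp_assoc[OF h(1) diff_pow_hom[OF X] h(2)] by simp
  finally show ?case .
qed

lemma diff_pow_natural:
  assumes X: "is_diagram C X" and Y: "is_diagram C Y" and f: "is_diagram_map C X Y f"
  shows "f (n + int k) \<cdot> diff_pow C X k n = diff_pow C Y k n \<cdot> f n"
proof -
  have f': "f m \<in> Hom C (ob X m) (ob Y m)" "f (m + 1) \<cdot> diff X m = diff Y m \<cdot> f m" for m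
    using f by (simp_all add: is_diagram_map_def)
  have d: "diff X m \<in> Hom C (ob X m) (ob X (m + 1))" "diff Y m \<in> Hom C (ob Y m) (ob Y (m + 1))" for m
    using X Y by (simp_all add: is_diagram_def)
  show ?thesis
  proof (induction k)
    case 0
    then show ?case using comp_ide_left[OF f'(1)] comp_ide_right[OF f'(1)] by simp
  next
    case (Suc k)
    let ?m = "n + int k"
    have "f (?m + 1) \<cdot> (diff X ?m \<cdot> diff_pow C X k n) = (diff Y ?m \<cdot> f ?m) \<cdot> diff_pow C X k n"
      using comp_assoc[OF diff_pow_hom[OF X] d(1) f'(1)] f'(2) by simp
    also have "\<dots> = diff Y ?m \<cdot> (diff_pow C Y k n \<cdot> f n)"
      using comp_assoc[OF diff_pow_hom[OF X] f'(1) d(2)] Suc by simp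
    also have "\<dots> = (diff Y ?m \<cdot> diff_pow C Y k n) \<cdot> f n"
      using comp_assoc[OF f'(1) diff_pow_hom[OF Y] d(2)] by simp
    finally show ?case by (simp add: ac_simps)
  qed
qed

text \<open>
  Jointly monic families reflect all the conditions on complexes and their maps. This is how
  differentials that are obtained degreewise from a universal property are seen to be
  \<open>N\<close>-nilpotent, and degreewise factorisations to be morphisms of complexes.
\<close>

definition jointly_monic ::
  "('o, 'm) cplx \<Rightarrow> (int \<Rightarrow> 'm) \<Rightarrow> ('o, 'm) cplx \<Rightarrow> (int \<Rightarrow> 'm) \<Rightarrow> ('o, 'm) cplx \<Rightarrow> bool" where
  "jointly_monic E p X q Y \<longleftrightarrow> is_diagram_map C E X p \<and> is_diagram_map C E Y q \<and>
     (\<forall>n T u v. u \<in> Hom C T (ob E n) \<longrightarrow> v \<in> Hom C T (ob E n) \<longrightarrow>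
        p n \<cdot> u = p n \<cdot> v \<longrightarrow> q n \<cdot> u = q n \<cdot> v \<longrightarrow> u = v)"

lemma ncomplex_of_jointly_monic:
  assumes E: "is_diagram C E" and X: "is_ncomplex N C X" and Y: "is_ncomplex N C Y"
    and m: "jointly_monic E p X q Y"
  shows "is_ncomplex N C E"
proof -
  have z: "f (n + int N) \<cdot> diff_pow C E N n = f (n + int N) \<cdot> Zero C (ob E n) (ob E (n + int N))"
    if f: "is_diagram_map C E W f" and W: "is_ncomplex N C W" for f W n
  proof -
    have h: "f m \<in> Hom C (ob E m) (ob W m)" for m using f by (simp add: is_diagram_map_def)
    have "f (n + int N) \<cdot> diff_pow C E N n = Zero C (ob W n) (ob W (n + int N)) \<cdot> f n"
      using diff_pow_natural[OF E ncomplexD(1)[OF W] f] ncomplexD(4)[OF W] by simp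
    then show ?thesis
      using comp_zero_left[OF h ncomplexD(2)[OF W]] comp_zero_right[OF h hom_obj1[OF h]] by simp
  qed
  have "diff_pow C E N n = Zero C (ob E n) (ob E (n + int N))" for n
  proof -
    have "Zero C (ob E n) (ob E (n + int N)) \<in> Hom C (ob E n) (ob E (n + int N))"
      using E zero_hom by (simp add: is_diagram_def)
    then show ?thesis
      using m z[OF _ X, of p n] z[OF _ Y, of q n] diff_pow_hom[OF E, of N n]
      unfolding jointly_monic_def by blast
  qed
  then show ?thesis using E by (simp add: is_ncomplex_iff)
qed

lemma diagram_map_of_jointly_monic:
  assumes m: "jointly_monic E p X q Y" and E: "is_diagram C E"
    and T: "is_diagram C T" and u: "\<And>n. u n \<in> Hom C (ob T n) (ob E n)"
    and pu: "is_diagram_map C T X (\<lambda>n. p n \<cdot> u n)" and qu: "is_diagram_map C T Y (\<lambda>n. q n \<cdot> u n)"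
    and XY: "is_diagram C X" "is_diagram C Y"
  shows "is_diagram_map C T E u"
proof -
  have d: "diff T n \<in> Hom C (ob T n) (ob T (n + 1))" "diff E n \<in> Hom C (ob E n) (ob E (n + 1))" for n
    using T E by (simp_all add: is_diagram_def)
  have z: "f (n + 1) \<cdot> (u (n + 1) \<cdot> diff T n) = f (n + 1) \<cdot> (diff E n \<cdot> u n)"
    if f: "is_diagram_map C E W f" and fu: "is_diagram_map C T W (\<lambda>n. f n \<cdot> u n)"
      and W: "is_diagram C W" for f W n
  proof -
    have h: "f m \<in> Hom C (ob E m) (ob W m)" "f (m + 1) \<cdot> diff E m = diff W m \<cdot> f m" for m
      using f by (simp_all add: is_diagram_map_def)
    have w: "diff W m \<in> Hom C (ob W m) (ob W (m + 1))" for m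
      using W by (simp add: is_diagram_def)
    have "f (n + 1) \<cdot> (u (n + 1) \<cdot> diff T n) = (f (n + 1) \<cdot> u (n + 1)) \<cdot> diff T n"
      by (rule comp_assoc[OF d(1) u h(1), symmetric])
    also have "\<dots> = diff W n \<cdot> (f n \<cdot> u n)" using fu by (simp add: is_diagram_map_def)
    also have "\<dots> = (f (n + 1) \<cdot> diff E n) \<cdot> u n" using comp_assoc[OF u h(1) w] h(2) by simp
    also have "\<dots> = f (n + 1) \<cdot> (diff E n \<cdot> u n)" by (rule comp_assoc[OF u d(2) h(1)])
    finally show ?thesis .
  qed
  have "u (n + 1) \<cdot> diff T n = diff E n \<cdot> u n" for n
    using m z[OF _ pu XY(1), of n] z[OF _ qu XY(2), of n] comp_hom[OF d(1) u] comp_hom[OF u d(2)]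
    unfolding jointly_monic_def by blast
  then show ?thesis using u by (simp add: is_diagram_map_def)
qed

lemma ide_diagram_map:
  assumes "is_ncomplex N C X"
  shows "is_diagram_map C X X (\<lambda>n. Ide C (ob X n))"
  using ide_hom[OF ncomplexD(2)[OF assms]] comp_ide_left[OF ncomplexD(3)[OF assms]]
    comp_ide_right[OF ncomplexD(3)[OF assms]] by (simp add: is_diagram_map_def)

lemma zero_diagram_map:
  assumes "is_ncomplex N C X" "is_ncomplex N C Y"
  shows "is_diagram_map C X Y (\<lambda>n. Zero C (ob X n) (ob Y n))"
  using zero_hom[OF ncomplexD(2)[OF assms(1)] ncomplexD(2)[OF assms(2)]]
    comp_zero_left[OF ncomplexD(3)[OF assms(1)] ncomplexD(2)[OF assms(2)]]
    comp_zero_right[OF ncomplexD(3)[OF assms(2)] ncomplexD(2)[OF assms(1)]]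
  by (simp add: is_diagram_map_def)

lemma ncomplexes_preadditive: "preadditive_category (ncomplexes N C)"
proof (intro preadditive_category.intro category.intro preadditive_category_axioms.intro)
  fix X Y Z W and f f' g g' h
  show "f \<in> Hom (ncomplexes N C) X Y \<Longrightarrow> X \<in> Obj (ncomplexes N C) \<and> Y \<in> Obj (ncomplexes N C)"
    by (simp add: ncomplexes_hom_iff)
  show "X \<in> Obj (ncomplexes N C) \<Longrightarrow> Ide (ncomplexes N C) X \<in> Hom (ncomplexes N C) X X"
    using ide_diagram_map by (simp add: ncomplexes_hom_iff)
  show comp: "g \<cdot>\<^bsub>ncomplexes N C\<^esub> f \<in> Hom (ncomplexes N C) X Z"
    if f: "f \<in> Hom (ncomplexes N C) X Y" and g: "g \<in> Hom (ncomplexes N C) Y Z"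
  proof -
    note F = ncomplexes_homD[OF f] and G = ncomplexes_homD[OF g]
    have "(g (n + 1) \<cdot> f (n + 1)) \<cdot> diff X n = diff Z n \<cdot> (g n \<cdot> f n)" for n
      using comp_assoc[OF ncomplexD(3)[OF F(1)] F(4) G(4)] F(5)
        comp_assoc[OF F(4) ncomplexD(3)[OF F(2)] G(4)] G(5)
        comp_assoc[OF F(4) G(4) ncomplexD(3)[OF G(2)]] by simp
    then show ?thesis
      using F(1) G(2) comp_hom[OF F(4) G(4)] by (simp add: ncomplexes_hom_iff is_diagram_map_def)
  qed
  show "f \<cdot>\<^bsub>ncomplexes N C\<^esub> Ide (ncomplexes N C) X = f" "Ide (ncomplexes N C) Y \<cdot>\<^bsub>ncomplexes N C\<^esub> f = f"
    if f: "f \<in> Hom (ncomplexes N C) X Y"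
    using comp_ide_right[OF ncomplexes_homD(4)[OF f]] comp_ide_left[OF ncomplexes_homD(4)[OF f]]
    by simp_all
  show "(h \<cdot>\<^bsub>ncomplexes N C\<^esub> g) \<cdot>\<^bsub>ncomplexes N C\<^esub> f = h \<cdot>\<^bsub>ncomplexes N C\<^esub> (g \<cdot>\<^bsub>ncomplexes N C\<^esub> f)"
    if "f \<in> Hom (ncomplexes N C) W X" "g \<in> Hom (ncomplexes N C) X Y" "h \<in> Hom (ncomplexes N C) Y Z"
    using comp_assoc[OF that[THEN ncomplexes_homD(4)]] by simp
  show "g \<cdot>\<^bsub>ncomplexes N C\<^esub> (f \<boxplus>\<^bsub>ncomplexes N C\<^esub> f') =
      g \<cdot>\<^bsub>ncomplexes N C\<^esub> f \<boxplus>\<^bsub>ncomplexes N C\<^esub> g \<cdot>\<^bsub>ncomplexes N C\<^esub> f'"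
    if "f \<in> Hom (ncomplexes N C) X Y" "f' \<in> Hom (ncomplexes N C) X Y" "g \<in> Hom (ncomplexes N C) Y Z"
    using comp_add_right[OF that[THEN ncomplexes_homD(4)]] by simp
  show "(g \<boxplus>\<^bsub>ncomplexes N C\<^esub> g') \<cdot>\<^bsub>ncomplexes N C\<^esub> f =
      g \<cdot>\<^bsub>ncomplexes N C\<^esub> f \<boxplus>\<^bsub>ncomplexes N C\<^esub> g' \<cdot>\<^bsub>ncomplexes N C\<^esub> f"
    if "f \<in> Hom (ncomplexes N C) X Y" "g \<in> Hom (ncomplexes N C) Y Z" "g' \<in> Hom (ncomplexes N C) Y Z"
    using comp_add_left[OF that[THEN ncomplexes_homD(4)]] by simp
next
  fix X Y assume "X \<in> Obj (ncomplexes N C)" "Y \<in> Obj (ncomplexes N C)"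
  then have XY: "is_ncomplex N C X" "is_ncomplex N C Y" by simp_all
  note X = ncomplexD[OF XY(1)] and Y = ncomplexD[OF XY(2)]
  have hom: "f \<in> Hom (ncomplexes N C) X Y \<longleftrightarrow> (\<forall>n. f n \<in> Hom C (ob X n) (ob Y n)) \<and>
    (\<forall>n. f (n + 1) \<cdot> diff X n = diff Y n \<cdot> f n)" for f
    using XY by (simp add: ncomplexes_hom_iff is_diagram_map_def)
  show "comm_group (hom_group (ncomplexes N C) X Y)"
  proof (rule comm_groupI)
    fix f g
    assume "f \<in> carrier (hom_group (ncomplexes N C) X Y)" "g \<in> carrier (hom_group (ncomplexes N C) X Y)"
    then have fg: "f \<in> Hom (ncomplexes N C) X Y" "g \<in> Hom (ncomplexes N C) X Y"
      by (simp_all add: hom_group_def)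
    note F = ncomplexes_homD[OF fg(1)] and G = ncomplexes_homD[OF fg(2)]
    have "(f (n + 1) \<boxplus> g (n + 1)) \<cdot> diff X n = diff Y n \<cdot> (f n \<boxplus> g n)" for n
      using comp_add_left[OF X(3) F(4) G(4)] comp_add_right[OF F(4) G(4) Y(3)] F(5) G(5) by simp
    then show "f \<otimes>\<^bsub>hom_group (ncomplexes N C) X Y\<^esub> g \<in> carrier (hom_group (ncomplexes N C) X Y)"
      using add_hom[OF F(4) G(4)] by (simp add: hom_group_def hom)
    show "f \<otimes>\<^bsub>hom_group (ncomplexes N C) X Y\<^esub> g = g \<otimes>\<^bsub>hom_group (ncomplexes N C) X Y\<^esub> f"
      using add_comm[OF F(4) G(4)] by (simp add: hom_group_def)
  next
    fix f g h
    assume "f \<in> carrier (hom_group (ncomplexes N C) X Y)" "g \<in> carrier (hom_group (ncomplexes N C) X Y)"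
      "h \<in> carrier (hom_group (ncomplexes N C) X Y)"
    then have fgh: "f \<in> Hom (ncomplexes N C) X Y" "g \<in> Hom (ncomplexes N C) X Y"
      "h \<in> Hom (ncomplexes N C) X Y"
      by (simp_all add: hom_group_def)
    show "f \<otimes>\<^bsub>hom_group (ncomplexes N C) X Y\<^esub> g \<otimes>\<^bsub>hom_group (ncomplexes N C) X Y\<^esub> h =
      f \<otimes>\<^bsub>hom_group (ncomplexes N C) X Y\<^esub> (g \<otimes>\<^bsub>hom_group (ncomplexes N C) X Y\<^esub> h)"
      using add_assoc[OF fgh[THEN ncomplexes_homD(4)]] by (simp add: hom_group_def)
  next
    show "\<one>\<^bsub>hom_group (ncomplexes N C) X Y\<^esub> \<in> carrier (hom_group (ncomplexes N C) X Y)"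
      using zero_hom[OF X(2) Y(2)] comp_zero_left[OF X(3) Y(2)] comp_zero_right[OF Y(3) X(2)]
      by (simp add: hom_group_def hom)
  next
    fix f assume "f \<in> carrier (hom_group (ncomplexes N C) X Y)"
    then have f: "f \<in> Hom (ncomplexes N C) X Y" by (simp add: hom_group_def)
    note F = ncomplexes_homD[OF f]
    show "\<one>\<^bsub>hom_group (ncomplexes N C) X Y\<^esub> \<otimes>\<^bsub>hom_group (ncomplexes N C) X Y\<^esub> f = f"
      using add_zero_left[OF F(4)] by (simp add: hom_group_def)
    have "\<exists>g. \<forall>n. g n \<in> Hom C (ob X n) (ob Y n) \<and> g n \<boxplus> f n = Zero C (ob X n) (ob Y n)"
      using ex_neg[OF F(4)] by metis
    then obtain g where g: "\<And>n. g n \<in> Hom C (ob X n) (ob Y n)"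
      "\<And>n. g n \<boxplus> f n = Zero C (ob X n) (ob Y n)" by blast
    have "g (n + 1) \<cdot> diff X n = diff Y n \<cdot> g n" for n
    proof -
      let ?a = "g (n + 1) \<cdot> diff X n" and ?b = "diff Y n \<cdot> g n" and ?c = "diff Y n \<cdot> f n"
      let ?z = "Zero C (ob X n) (ob Y (n + 1))"
      note h = comp_hom[OF X(3) g(1)] comp_hom[OF g(1) Y(3)] comp_hom[OF F(4) Y(3)]
      have a: "?a \<boxplus> ?c = ?z"
        using comp_add_left[OF X(3) g(1) F(4)] F(5) g(2) comp_zero_left[OF X(3) Y(2)] by simp
      have b: "?b \<boxplus> ?c = ?z"
        using comp_add_right[OF g(1) F(4) Y(3)] g(2) comp_zero_right[OF Y(3) X(2)] by simp
      have "?a = ?a \<boxplus> (?c \<boxplus> ?b)" using b add_comm[OF h(2,3)] add_zero_right[OF h(1)] by simp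
      also have "\<dots> = ?b" using a add_zero_left[OF h(2)] by (simp add: add_assoc[OF h(1,3,2), symmetric])
      finally show ?thesis .
    qed
    then show "\<exists>g \<in> carrier (hom_group (ncomplexes N C) X Y).
        g \<otimes>\<^bsub>hom_group (ncomplexes N C) X Y\<^esub> f = \<one>\<^bsub>hom_group (ncomplexes N C) X Y\<^esub>"
      using g by (intro bexI[of _ g]) (simp_all add: hom_group_def hom)
  qed
qed

lemma levelwise_kernel:
  assumes i: "i \<in> Hom (ncomplexes N C) X Y" and p: "p \<in> Hom (ncomplexes N C) Y Z"
    and k: "\<And>n. is_kernel C (ob X n) (i n) (ob Y n) (p n) (ob Z n)"
  shows "is_kernel (ncomplexes N C) X i Y p Z"
proof (rule preadditive_category.kernelI[OF ncomplexes_preadditive i p])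
  note I = ncomplexes_homD[OF i] and K = kernelD[OF k]
  show "p \<cdot>\<^bsub>ncomplexes N C\<^esub> i = Zero (ncomplexes N C) X Z" using K(3) by simp
  fix t T assume t: "t \<in> Hom (ncomplexes N C) T Y"
    "p \<cdot>\<^bsub>ncomplexes N C\<^esub> t = Zero (ncomplexes N C) T Z"
  note T = ncomplexes_homD[OF t(1)]
  have "\<exists>u. \<forall>n. u n \<in> Hom C (ob T n) (ob X n) \<and> i n \<cdot> u n = t n"
    using K(4)[OF T(4)] t(2) by (simp add: fun_eq_iff) metis
  then obtain u where u: "\<And>n. u n \<in> Hom C (ob T n) (ob X n)" "\<And>n. i n \<cdot> u n = t n" by blast
  have "jointly_monic X i Y i Y"
    unfolding jointly_monic_def using I(3) K(5) by blast
  then have "is_diagram_map C T X u"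
    using diagram_map_of_jointly_monic[of X i Y i Y T u] u T(3) I(1,2) T(1)
    by (simp add: ncomplexD(1))
  then show "\<exists>u \<in> Hom (ncomplexes N C) T X. i \<cdot>\<^bsub>ncomplexes N C\<^esub> u = t"
    using u(2) T(1) I(1) by (intro bexI[of _ u]) (simp_all add: ncomplexes_hom_iff)
next
  fix u v T assume uv: "u \<in> Hom (ncomplexes N C) T X" "v \<in> Hom (ncomplexes N C) T X"
    "i \<cdot>\<^bsub>ncomplexes N C\<^esub> u = i \<cdot>\<^bsub>ncomplexes N C\<^esub> v"
  show "u = v"
  proof
    fix n
    have "i n \<cdot> u n = i n \<cdot> v n" using uv(3) by (simp add: fun_eq_iff)
    then show "u n = v n" by (rule kernelD(5)[OF k uv(1,2)[THEN ncomplexes_homD(4)]])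
  qed
qed

lemma kernel_complex:
  assumes p: "p \<in> Hom (ncomplexes N C) Y Z"
    and k: "\<And>n. is_kernel C (K n) (k n) (ob Y n) (p n) (ob Z n)"
  shows "\<exists>d. k \<in> Hom (ncomplexes N C) \<lparr>ob = K, diff = d\<rparr> Y"
proof -
  note P = ncomplexes_homD[OF p] and Y = ncomplexD[OF ncomplexes_homD(1)[OF p]]
    and Z = ncomplexD[OF ncomplexes_homD(2)[OF p]] and K = kernelD[OF k]
  have "p (n + 1) \<cdot> (diff Y n \<cdot> k n) = Zero C (K n) (ob Z (n + 1))" for n
    using comp_assoc[OF K(1) Y(3) P(4)] comp_assoc[OF K(1) P(4) Z(3)] P(5) K(3)
      comp_zero_right[OF Z(3) hom_obj1[OF K(1)]] by simp
  then have "\<exists>u. u \<in> Hom C (K n) (K (n + 1)) \<and> k (n + 1) \<cdot> u = diff Y n \<cdot> k n" for n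
    using K(4)[OF comp_hom[OF K(1) Y(3)]] by blast
  then obtain d where d: "\<And>n. d n \<in> Hom C (K n) (K (n + 1))"
    "\<And>n. k (n + 1) \<cdot> d n = diff Y n \<cdot> k n" by metis
  let ?K = "\<lparr>ob = K, diff = d\<rparr>"
  have diag: "is_diagram C ?K" unfolding is_diagram_def using d hom_obj1[OF K(1)] by simp
  have map: "is_diagram_map C ?K Y k" unfolding is_diagram_map_def using d K(1) by simp
  have "jointly_monic ?K k Y k Y"
    unfolding jointly_monic_def using map K(5) by simp
  then have "is_ncomplex N C ?K" using ncomplex_of_jointly_monic diag P(1) by blast
  then have "k \<in> Hom (ncomplexes N C) ?K Y" using map P(1) by (simp add: ncomplexes_hom_iff)
  then show ?thesis by blast
qed

lemma levelwise_pullback: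
  assumes p: "p \<in> Hom (ncomplexes N C) Y Z" and f: "f \<in> Hom (ncomplexes N C) Z' Z"
    and ex: "\<And>n. \<exists>P p' f'. is_pullback C P p' f' (ob Z' n) (ob Y n) (p n) (f n) (ob Z n)"
  shows "\<exists>P p' f'. is_pullback (ncomplexes N C) P p' f' Z' Y p f Z"
proof -
  note p' = ncomplexes_homD[OF p] and f' = ncomplexes_homD[OF f]
  note Y = ncomplexD[OF p'(1)] and Z' = ncomplexD[OF f'(1)] and Z = ncomplexD[OF p'(2)]
  obtain Q q g where pb: "\<And>n. is_pullback C (Q n) (q n) (g n) (ob Z' n) (ob Y n) (p n) (f n) (ob Z n)"
    using ex by metis
  note P = pullbackD[OF pb]
  have "\<exists>u. u \<in> Hom C (Q n) (Q (n + 1)) \<and> q (n + 1) \<cdot> u = diff Z' n \<cdot> q n \<and>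
    g (n + 1) \<cdot> u = diff Y n \<cdot> g n" for n
  proof -
    have "f (n + 1) \<cdot> (diff Z' n \<cdot> q n) = diff Z n \<cdot> (f n \<cdot> q n)"
      using comp_assoc[OF P(1) Z'(3) f'(4)] comp_assoc[OF P(1) f'(4) Z(3)] f'(5) by simp
    also have "\<dots> = p (n + 1) \<cdot> (diff Y n \<cdot> g n)"
      using comp_assoc[OF P(2) Y(3) p'(4)] comp_assoc[OF P(2) p'(4) Z(3)] p'(5) P(5) by simp
    finally show ?thesis using P(6)[OF comp_hom[OF P(1) Z'(3)] comp_hom[OF P(2) Y(3)]] by blast
  qed
  then obtain d where d: "\<And>n. d n \<in> Hom C (Q n) (Q (n + 1))"
    "\<And>n. q (n + 1) \<cdot> d n = diff Z' n \<cdot> q n" "\<And>n. g (n + 1) \<cdot> d n = diff Y n \<cdot> g n" by metis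
  let ?Q = "\<lparr>ob = Q, diff = d\<rparr>"
  have diag: "is_diagram C ?Q" unfolding is_diagram_def using d hom_obj1[OF P(1)] by simp
  have map: "is_diagram_map C ?Q Z' q" "is_diagram_map C ?Q Y g"
    unfolding is_diagram_map_def using d P(1,2) by simp_all
  have jm: "jointly_monic ?Q q Z' g Y"
    unfolding jointly_monic_def using map P(7) by simp
  have Q: "is_ncomplex N C ?Q" using ncomplex_of_jointly_monic[OF diag f'(1) p'(1) jm] .
  have hom: "q \<in> Hom (ncomplexes N C) ?Q Z'" "g \<in> Hom (ncomplexes N C) ?Q Y"
    using Q map f'(1) p'(1) by (simp_all add: ncomplexes_hom_iff)
  have "is_pullback (ncomplexes N C) ?Q q g Z' Y p f Z"
  proof (rule preadditive_category.pullbackI[OF ncomplexes_preadditive hom p f])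
    show "f \<cdot>\<^bsub>ncomplexes N C\<^esub> q = p \<cdot>\<^bsub>ncomplexes N C\<^esub> g" using P(5) by simp
    fix a b T assume ab: "a \<in> Hom (ncomplexes N C) T Z'" "b \<in> Hom (ncomplexes N C) T Y"
      "f \<cdot>\<^bsub>ncomplexes N C\<^esub> a = p \<cdot>\<^bsub>ncomplexes N C\<^esub> b"
    note A = ncomplexes_homD[OF ab(1)] and B = ncomplexes_homD[OF ab(2)]
    have "f n \<cdot> a n = p n \<cdot> b n" for n using ab(3) by (simp add: fun_eq_iff)
    then have "\<exists>u. u \<in> Hom C (ob T n) (Q n) \<and> q n \<cdot> u = a n \<and> g n \<cdot> u = b n" for n
      using P(6)[OF A(4) B(4)] by blast
    then obtain u where u: "\<And>n. u n \<in> Hom C (ob T n) (Q n)" "\<And>n. q n \<cdot> u n = a n"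
      "\<And>n. g n \<cdot> u n = b n" by metis
    have "is_diagram_map C T ?Q u"
      by (rule diagram_map_of_jointly_monic[OF jm diag ncomplexD(1)[OF A(1)]])
        (use u A(3) B(3) Z'(1) Y(1) in simp_all)
    then have "u \<in> Hom (ncomplexes N C) T ?Q" using Q A(1) by (simp add: ncomplexes_hom_iff)
    then show "\<exists>u \<in> Hom (ncomplexes N C) T ?Q.
        q \<cdot>\<^bsub>ncomplexes N C\<^esub> u = a \<and> g \<cdot>\<^bsub>ncomplexes N C\<^esub> u = b"
      using u(2,3) by (intro bexI[of _ u]) simp_all
  next
    fix u v T assume uv: "u \<in> Hom (ncomplexes N C) T ?Q" "v \<in> Hom (ncomplexes N C) T ?Q"
      "q \<cdot>\<^bsub>ncomplexes N C\<^esub> u = q \<cdot>\<^bsub>ncomplexes N C\<^esub> v" "g \<cdot>\<^bsub>ncomplexes N C\<^esub> u = g \<cdot>\<^bsub>ncomplexes N C\<^esub> v"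
    show "u = v"
    proof
      fix n
      have "q n \<cdot> u n = q n \<cdot> v n" "g n \<cdot> u n = g n \<cdot> v n" using uv(3,4) by (simp_all add: fun_eq_iff)
      then show "u n = v n"
        using P(7)[OF uv(1,2)[THEN ncomplexes_homD(4), simplified]] by blast
    qed
  qed
  then show ?thesis by blast
qed

lemma levelwise_biproduct:
  assumes X: "is_ncomplex N C X" and Y: "is_ncomplex N C Y"
    and b: "\<And>n. is_biproduct C (ob X n) (ob Y n) (D n) (i n) (j n) (p n) (q n)"
  shows "\<exists>d. is_biproduct (ncomplexes N C) X Y \<lparr>ob = D, diff = d\<rparr> i j p q"
proof -
  note B = biproductD[OF b] and X' = ncomplexD[OF X] and Y' = ncomplexD[OF Y]
  have "\<exists>u. u \<in> Hom C (D n) (D (n + 1)) \<and> p (n + 1) \<cdot> u = diff X n \<cdot> p n \<and>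
    q (n + 1) \<cdot> u = diff Y n \<cdot> q n" for n
    using biproduct_pairing[OF b comp_hom[OF B(3) X'(3)] comp_hom[OF B(4) Y'(3)]] by blast
  then obtain d where d: "\<And>n. d n \<in> Hom C (D n) (D (n + 1))"
    "\<And>n. p (n + 1) \<cdot> d n = diff X n \<cdot> p n" "\<And>n. q (n + 1) \<cdot> d n = diff Y n \<cdot> q n" by metis
  let ?D = "\<lparr>ob = D, diff = d\<rparr>"
  have diag: "is_diagram C ?D" unfolding is_diagram_def using d B(12) by simp
  have map: "is_diagram_map C ?D X p" "is_diagram_map C ?D Y q"
    unfolding is_diagram_map_def using d B(3,4) by simp_all
  have jm: "jointly_monic ?D p X q Y"
    unfolding jointly_monic_def using map biproduct_jointly_monic[OF b] by simp
  have D: "is_ncomplex N C ?D" using ncomplex_of_jointly_monic[OF diag X Y jm] .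
  have "is_diagram_map C X ?D i"
    by (rule diagram_map_of_jointly_monic[OF jm diag X'(1)])
      (use B(1,5,8) ide_diagram_map zero_diagram_map X Y X'(1) Y'(1) in simp_all)
  moreover have "is_diagram_map C Y ?D j"
    by (rule diagram_map_of_jointly_monic[OF jm diag Y'(1)])
      (use B(2,6,7) ide_diagram_map zero_diagram_map X Y X'(1) Y'(1) in simp_all)
  ultimately have "is_biproduct (ncomplexes N C) X Y ?D i j p q"
    unfolding is_biproduct_def using B(5-9) map X Y D by (simp add: ncomplexes_hom_iff)
  then show ?thesis by blast
qed

end

lemma (in additive_category) ncomplexes_additive: "additive_category (ncomplexes N C)"
proof (intro additive_category.intro ncomplexes_preadditive additive_category_axioms.intro)
  obtain Z where zero: "zero_object C Z" using ex_zero_object ..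
  then have Z: "Z \<in> Obj C" "\<And>X. X \<in> Obj C \<Longrightarrow> \<exists>!f. f \<in> Hom C X Z"
    "\<And>X. X \<in> Obj C \<Longrightarrow> \<exists>!f. f \<in> Hom C Z X"
    by (simp_all add: zero_object_def)
  have uniq: "f = g" if "f \<in> Hom C X Y" "g \<in> Hom C X Y" "X = Z \<or> Y = Z" for f g X Y
    using that Z(2)[OF hom_obj1[OF that(1)]] Z(3)[OF hom_obj2[OF that(1)]] by blast
  let ?Z = "\<lparr>ob = \<lambda>_. Z, diff = \<lambda>_. Zero C Z Z\<rparr>"
  have diag: "is_diagram C ?Z" unfolding is_diagram_def using Z(1) zero_hom by simp
  have cz: "is_ncomplex N C ?Z"
    unfolding is_ncomplex_iff using diag uniq[OF diff_pow_hom[OF diag]] zero_hom[OF Z(1,1)] by simp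
  have "\<exists>!f. f \<in> Hom (ncomplexes N C) X ?Z" "\<exists>!f. f \<in> Hom (ncomplexes N C) ?Z X"
    if X: "is_ncomplex N C X" for X
  proof -
    note X' = ncomplexD[OF X]
    have in': "(\<lambda>n. Zero C (ob X n) Z) \<in> Hom (ncomplexes N C) X ?Z"
      "(\<lambda>n. Zero C Z (ob X n)) \<in> Hom (ncomplexes N C) ?Z X"
      using X cz zero_hom[OF X'(2) Z(1)] zero_hom[OF Z(1) X'(2)]
        comp_zero_left[OF X'(3) Z(1)] comp_zero_right[OF X'(3) Z(1)]
        comp_zero_left[OF zero_hom[OF Z(1,1)] X'(2)] comp_zero_right[OF zero_hom[OF Z(1,1)] X'(2)]
      by (simp_all add: ncomplexes_hom_iff is_diagram_map_def)
    show "\<exists>!f. f \<in> Hom (ncomplexes N C) X ?Z"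
    proof (rule ex1I[of _ "\<lambda>n. Zero C (ob X n) Z"], rule in'(1), rule ext)
      fix f n assume "f \<in> Hom (ncomplexes N C) X ?Z"
      from ncomplexes_homD(4)[OF this, of n] show "f n = Zero C (ob X n) Z"
        using uniq[OF _ zero_hom[OF X'(2) Z(1)]] by simp
    qed
    show "\<exists>!f. f \<in> Hom (ncomplexes N C) ?Z X"
    proof (rule ex1I[of _ "\<lambda>n. Zero C Z (ob X n)"], rule in'(2), rule ext)
      fix f n assume "f \<in> Hom (ncomplexes N C) ?Z X"
      from ncomplexes_homD(4)[OF this, of n] show "f n = Zero C Z (ob X n)"
        using uniq[OF _ zero_hom[OF Z(1) X'(2)]] by simp
    qed
  qed
  then show "\<exists>Z. zero_object (ncomplexes N C) Z"
    unfolding zero_object_def using cz by (intro exI[of _ ?Z]) simp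
next
  fix X Y assume "X \<in> Obj (ncomplexes N C)" "Y \<in> Obj (ncomplexes N C)"
  then have XY: "is_ncomplex N C X" "is_ncomplex N C Y" by simp_all
  have "\<exists>D i j p q. is_biproduct C (ob X n) (ob Y n) D i j p q" for n
    using ex_biproduct[OF ncomplexD(2)[OF XY(1)] ncomplexD(2)[OF XY(2)]] .
  then obtain D i j p q
    where "\<And>n. is_biproduct C (ob X n) (ob Y n) (D n) (i n) (j n) (p n) (q n)" by metis
  from levelwise_biproduct[OF XY this]
  show "\<exists>D i j p q. is_biproduct (ncomplexes N C) X Y D i j p q" by blast
qed


section \<open>Levelwise split sequences\<close>

context preadditive_category
begin

lemma levelwise_split_iff:
  "(X, f, Y, g, Z) \<in> levelwise_split N C \<longleftrightarrow>
    f \<in> Hom (ncomplexes N C) X Y \<and> g \<in> Hom (ncomplexes N C) Y Z \<and>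
    (\<forall>n. \<exists>s r. is_biproduct C (ob X n) (ob Z n) (ob Y n) (f n) s r (g n))"
  by (simp add: levelwise_split_def split_seq_iff)

text \<open>
  Kernels chosen degree by degree inherit a differential from \<open>Y\<close>, so that the degreewise
  condition suffices.
\<close>

lemma levelwise_adm_epi_iff:
  "adm_epi (levelwise_split N C) Y p Z \<longleftrightarrow>
    p \<in> Hom (ncomplexes N C) Y Z \<and> (\<forall>n. split_epi C (ob Y n) (p n) (ob Z n))"
proof
  assume "adm_epi (levelwise_split N C) Y p Z"
  then show "p \<in> Hom (ncomplexes N C) Y Z \<and> (\<forall>n. split_epi C (ob Y n) (p n) (ob Z n))"
    unfolding adm_epi_def levelwise_split_iff split_epi_def by blast
next
  assume p: "p \<in> Hom (ncomplexes N C) Y Z \<and> (\<forall>n. split_epi C (ob Y n) (p n) (ob Z n))"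
  then have "\<exists>X i s r. is_biproduct C X (ob Z n) (ob Y n) i s r (p n)" for n
    by (simp add: split_epi_def)
  then obtain K k s r where b: "\<And>n. is_biproduct C (K n) (ob Z n) (ob Y n) (k n) (s n) (r n) (p n)"
    by metis
  obtain d where "k \<in> Hom (ncomplexes N C) \<lparr>ob = K, diff = d\<rparr> Y"
    using kernel_complex[OF _ biproduct_kernel[OF b]] p by blast
  then have "(\<lparr>ob = K, diff = d\<rparr>, k, Y, p, Z) \<in> levelwise_split N C"
    unfolding levelwise_split_iff using p b by auto
  then show "adm_epi (levelwise_split N C) Y p Z" unfolding adm_epi_def by blast
qed

lemma levelwise_split_isomorphic:
  assumes "s \<in> levelwise_split N C" "isomorphic_seqs (ncomplexes N C) s t"
  shows "t \<in> levelwise_split N C"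
proof -
  obtain X f Y g Z where s: "s = (X, f, Y, g, Z)" by (cases s)
  obtain X' f' Y' g' Z' where t: "t = (X', f', Y', g', Z')" by (cases t)
  have h: "f \<in> Hom (ncomplexes N C) X Y" "g \<in> Hom (ncomplexes N C) Y Z"
    "f' \<in> Hom (ncomplexes N C) X' Y'" "g' \<in> Hom (ncomplexes N C) Y' Z'"
    and b: "\<And>n. \<exists>s r. is_biproduct C (ob X n) (ob Z n) (ob Y n) (f n) s r (g n)"
    using assms by (auto simp: s t levelwise_split_iff)
  have arrow: "iso_arrow C (ob W n) (ob W' n) (a n)" if "iso_arrow (ncomplexes N C) W W' a" for W W' a n
    using that unfolding iso_arrow_def by (auto simp: fun_eq_iff dest: ncomplexes_homD(4))
  have "isomorphic_seqs C (ob X n, f n, ob Y n, g n, ob Z n) (ob X' n, f' n, ob Y' n, g' n, ob Z' n)" for n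
  proof -
    obtain a b c where "iso_arrow (ncomplexes N C) X X' a" "iso_arrow (ncomplexes N C) Y Y' b"
      "iso_arrow (ncomplexes N C) Z Z' c"
      and "b n \<cdot> f n = f' n \<cdot> a n" "c n \<cdot> g n = g' n \<cdot> b n"
      using assms(2) by (auto simp: s t fun_eq_iff)
    then show ?thesis
      unfolding isomorphic_seqs.simps using h[THEN ncomplexes_homD(4)] arrow[where n = n] by blast
  qed
  with b have "\<exists>s r. is_biproduct C (ob X' n) (ob Z' n) (ob Y' n) (f' n) s r (g' n)" for n
    using biproduct_isomorphic by blast
  then show ?thesis using h by (simp add: t levelwise_split_iff)
qed

lemma levelwise_split_biproduct:
  assumes "is_biproduct (ncomplexes N C) X Y D i j p q"
  shows "(X, i, D, q, Y) \<in> levelwise_split N C"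
proof -
  have "is_biproduct C (ob X n) (ob Y n) (ob D n) (i n) (j n) (p n) (q n)" for n
    using assms unfolding is_biproduct_def by (auto simp: fun_eq_iff dest: ncomplexes_homD(4))
  then show ?thesis
    using assms unfolding levelwise_split_iff by (auto simp: is_biproduct_def)
qed

lemma levelwise_split_kernel:
  "(X, i, Y, p, Z) \<in> levelwise_split N C \<Longrightarrow> is_kernel (ncomplexes N C) X i Y p Z"
  unfolding levelwise_split_iff using levelwise_kernel biproduct_kernel by metis

end


section \<open>Free complexes\<close>

text \<open>
  The free complex on a family \<open>U\<close> of objects is \<open>\<Oplus>\<^sub>n (U n \<rightarrow> U n \<rightarrow> \<dots> \<rightarrow> U n)\<close> with identities as
  differentials, where the string of \<open>U n\<close> occupies the degrees \<open>n, \<dots>, n + N - 1\<close>. In degree \<open>m\<close> it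
  is the biproduct of the \<open>U n\<close> with \<open>m - N < n \<le> m\<close>. Since the inclusion \<open>\<iota> m n\<close>
  vanishes for \<open>n \<le> m - N\<close>, the equation for the differential also says that the strings end.
\<close>

definition is_free_complex ::
  "nat \<Rightarrow> ('o, 'm, 'e) preadditive_scheme \<Rightarrow> (int \<Rightarrow> 'o) \<Rightarrow> ('o, 'm) cplx \<Rightarrow>
    (int \<Rightarrow> int \<Rightarrow> 'm) \<Rightarrow> (int \<Rightarrow> int \<Rightarrow> 'm) \<Rightarrow> bool" where
  "is_free_complex N C U G \<iota> \<pi> \<longleftrightarrow> is_diagram C G \<and>
     (\<forall>m. is_family_biproduct C {m - int N<..m} U (ob G m) (\<iota> m) (\<pi> m)) \<and>
     (\<forall>m n. n \<le> m \<longrightarrow> diff G m \<cdot>\<^bsub>C\<^esub> \<iota> m n = \<iota> (m + 1) n)"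

context preadditive_category
begin

lemma free_complexD:
  assumes "is_free_complex N C U G \<iota> \<pi>"
  shows "is_diagram C G" "diff G m \<in> Hom C (ob G m) (ob G (m + 1))"
    "is_family_biproduct C {m - int N<..m} U (ob G m) (\<iota> m) (\<pi> m)"
    "n \<le> m \<Longrightarrow> diff G m \<cdot> \<iota> m n = \<iota> (m + 1) n"
    "U n \<in> Obj C" "\<iota> m n \<in> Hom C (U n) (ob G m)" "\<pi> m n \<in> Hom C (ob G m) (U n)"
proof -
  show b: "is_family_biproduct C {m - int N<..m} U (ob G m) (\<iota> m) (\<pi> m)" for m
    using assms by (simp add: is_free_complex_def)
  show "U n \<in> Obj C" "\<iota> m n \<in> Hom C (U n) (ob G m)" "\<pi> m n \<in> Hom C (ob G m) (U n)"
    using family_biproductD(1-3)[OF b] by auto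
qed (use assms in \<open>auto simp: is_free_complex_def is_diagram_def\<close>)

lemma free_complex_is_ncomplex:
  assumes G: "is_free_complex N C U G \<iota> \<pi>"
  shows "is_ncomplex N C G"
proof -
  note F = free_complexD[OF G]
  have pow: "diff_pow C G k m \<cdot> \<iota> m n = \<iota> (m + int k) n" if "n \<le> m" for k m n
  proof (induction k)
    case 0
    then show ?case using comp_ide_left[OF F(6)] by simp
  next
    case (Suc k)
    have "n \<le> m + int k" using that by simp
    then show ?case
      using comp_assoc[OF F(6)[where m = m and n = n] diff_pow_hom[OF F(1), where k = k]
          F(2)[where m = "m + int k"]] Suc F(4)[of n "m + int k"]
      by (simp add: ac_simps)
  qed
  have "diff_pow C G N m = Zero C (ob G m) (ob G (m + int N))" for m
  proof (rule family_jointly_epic[OF F(3) diff_pow_hom[OF F(1)]])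
    note obj = hom_obj2[OF F(6)]
    show "Zero C (ob G m) (ob G (m + int N)) \<in> Hom C (ob G m) (ob G (m + int N))"
      using zero_hom[OF obj obj] .
    fix n assume n: "n \<in> {m - int N<..m}"
    then have "diff_pow C G N m \<cdot> \<iota> m n = \<iota> (m + int N) n" using pow by simp
    also have "\<dots> = Zero C (U n) (ob G (m + int N))"
      using family_inclusion_zero[OF F(3), of n "m + int N"] n by simp
    finally show "diff_pow C G N m \<cdot> \<iota> m n = Zero C (ob G m) (ob G (m + int N)) \<cdot> \<iota> m n"
      using comp_zero_left[OF F(6) obj] by simp
  qed
  then show ?thesis using F(1) by (simp add: is_ncomplex_iff)
qed

lemma diff_pow_zero:
  assumes X: "is_ncomplex N C X" and k: "N \<le> k"
  shows "diff_pow C X k n = Zero C (ob X n) (ob X (n + int k))"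
  using k
proof (induction k rule: dec_induct)
  case base
  show ?case by (rule ncomplexD(4)[OF X])
next
  case (step k)
  then show ?case
    using comp_zero_right[OF ncomplexD(3)[OF X] ncomplexD(2)[OF X]] by (simp add: ac_simps)
qed

text \<open>
  A map from the free complex is determined by its values \<open>g n\<close> on the generators \<open>U n\<close>, and these
  may be prescribed: on the summand \<open>U n\<close> in degree \<open>m\<close> the map is \<open>d\<close> iterated \<open>m - n\<close> times after
  \<open>g n\<close>. It is compatible with the differential at the end of a string because \<open>d\<close> iterated \<open>N\<close>
  times is zero.
\<close>

lemma free_complex_extend:
  assumes G: "is_free_complex N C U G \<iota> \<pi>" and Y: "is_ncomplex N C Y"
    and g: "\<And>n. g n \<in> Hom C (U n) (ob Y n)"
  shows "\<exists>\<phi> \<in> Hom (ncomplexes N C) G Y. \<forall>n. \<phi> n \<cdot> \<iota> n n = g n"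
proof -
  note F = free_complexD[OF G] and Y' = ncomplexD[OF Y]
  define e where "e m n = diff_pow C Y (nat (m - n)) n \<cdot> g n" for m n
  have e_hom: "e m n \<in> Hom C (U n) (ob Y m)" if "n \<le> m" for m n
    using comp_hom[OF g[of n] diff_pow_hom[OF Y'(1), where k = "nat (m - n)"]] that
    by (simp add: e_def)
  have e_step: "e (m + 1) n = diff Y m \<cdot> e m n" if "n \<le> m" for m n
  proof -
    have "nat (m + 1 - n) = Suc (nat (m - n))" using that by simp
    then show ?thesis
      using comp_assoc[OF g[of n] diff_pow_hom[OF Y'(1), where k = "nat (m - n)"] Y'(3)] that
      by (simp add: e_def)
  qed
  have e_zero: "e m n = Zero C (U n) (ob Y m)" if "n \<le> m - int N" for m n
    using diff_pow_zero[OF Y, of "nat (m - n)" n] comp_zero_left[OF g Y'(2), of n m] that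
    by (simp add: e_def nat_le_iff le_nat_iff)
  have "\<exists>u. u \<in> Hom C (ob G m) (ob Y m) \<and> (\<forall>n \<in> {m - int N<..m}. u \<cdot> \<iota> m n = e m n)" for m
    using coproductD(3)[OF family_biproductD(6)[OF F(3)[where m = m]] Y'(2)[where n = m], of "e m"]
      e_hom[where m = m] by auto
  then obtain \<phi> where \<phi>: "\<And>m. \<phi> m \<in> Hom C (ob G m) (ob Y m)"
    "\<And>m n. n \<in> {m - int N<..m} \<Longrightarrow> \<phi> m \<cdot> \<iota> m n = e m n" by metis
  have \<phi>e: "\<phi> m \<cdot> \<iota> m n = e m n" if "n \<le> m" for m n
  proof (cases "m - int N < n")
    case True
    then show ?thesis using \<phi>(2) that by simp
  next
    case False
    then show ?thesis
      using family_inclusion_zero[OF F(3), of n m] e_zero[of n m] comp_zero_right[OF \<phi>(1) F(5)] by simp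
  qed
  have "\<phi> (m + 1) \<cdot> diff G m = diff Y m \<cdot> \<phi> m" for m
  proof (rule family_jointly_epic[OF F(3) comp_hom[OF F(2) \<phi>(1)] comp_hom[OF \<phi>(1) Y'(3)]])
    fix n assume "n \<in> {m - int N<..m}"
    then have n: "n \<le> m" by simp
    have "(\<phi> (m + 1) \<cdot> diff G m) \<cdot> \<iota> m n = e (m + 1) n"
      using comp_assoc[OF F(6,2) \<phi>(1)] F(4)[OF n] \<phi>e[of n "m + 1"] n by simp
    also have "\<dots> = (diff Y m \<cdot> \<phi> m) \<cdot> \<iota> m n"
      using comp_assoc[OF F(6) \<phi>(1) Y'(3)] \<phi>e[OF n] e_step[OF n] by simp
    finally show "(\<phi> (m + 1) \<cdot> diff G m) \<cdot> \<iota> m n = (diff Y m \<cdot> \<phi> m) \<cdot> \<iota> m n" .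
  qed
  then have "\<phi> \<in> Hom (ncomplexes N C) G Y"
    using \<phi>(1) Y free_complex_is_ncomplex[OF G] by (simp add: ncomplexes_hom_iff is_diagram_map_def)
  moreover have "\<phi> n \<cdot> \<iota> n n = g n" for n
    using \<phi>e[of n n] comp_ide_left[OF g] by (simp add: e_def)
  ultimately show ?thesis by blast
qed

lemma free_complex_unique:
  assumes G: "is_free_complex N C U G \<iota> \<pi>"
    and f: "\<phi> \<in> Hom (ncomplexes N C) G Y" "\<psi> \<in> Hom (ncomplexes N C) G Y"
    and eq: "\<And>n. \<phi> n \<cdot> \<iota> n n = \<psi> n \<cdot> \<iota> n n"
  shows "\<phi> = \<psi>"
proof
  fix m
  note F = free_complexD[OF G] and Y = ncomplexD[OF ncomplexes_homD(2)[OF f(1)]]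
  have "\<phi> m \<cdot> \<iota> m n = \<psi> m \<cdot> \<iota> m n" if "n \<le> m" for m n
    using that
  proof (induction m rule: int_ge_induct)
    case base
    then show ?case by (rule eq)
  next
    case (step m)
    have "\<theta> (m + 1) \<cdot> \<iota> (m + 1) n = diff Y m \<cdot> (\<theta> m \<cdot> \<iota> m n)"
      if t: "\<theta> \<in> Hom (ncomplexes N C) G Y" for \<theta>
      using F(4)[OF step(1)] comp_assoc[OF F(6,2) ncomplexes_homD(4)[OF t]] ncomplexes_homD(5)[OF t]
        comp_assoc[OF F(6) ncomplexes_homD(4)[OF t] Y(3)] by metis
    then show ?case using f step(2) by simp
  qed
  then show "\<phi> m = \<psi> m"
    using family_jointly_epic[OF F(3) f[THEN ncomplexes_homD(4)], of m] by simp
qed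

text \<open>
  Degreewise sections of \<open>p\<close> need not form a map of complexes, but they suffice to lift \<open>f\<close> on the
  generators, where a map from a free complex can be prescribed at will.
\<close>

lemma free_complex_projective:
  assumes G: "is_free_complex N C U G \<iota> \<pi>"
  shows "rel_projective (ncomplexes N C) (levelwise_split N C) G"
  unfolding rel_projective_def
proof (intro conjI allI impI ballI)
  show "G \<in> Obj (ncomplexes N C)" using free_complex_is_ncomplex[OF G] by simp
  note F = free_complexD[OF G]
  fix Y p Z f
  assume "adm_epi (levelwise_split N C) Y p Z" and f: "f \<in> Hom (ncomplexes N C) G Z"
  then have p: "p \<in> Hom (ncomplexes N C) Y Z" and split: "\<And>n. split_epi C (ob Y n) (p n) (ob Z n)"
    by (simp_all add: levelwise_adm_epi_iff)
  note P = ncomplexes_homD[OF p] and f' = ncomplexes_homD[OF f]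
  have "\<exists>s. s \<in> Hom C (ob Z n) (ob Y n) \<and> p n \<cdot> s = Ide C (ob Z n)" for n
    using split[of n] by (rule split_epiE) blast
  then obtain s where s: "\<And>n. s n \<in> Hom C (ob Z n) (ob Y n)" "\<And>n. p n \<cdot> s n = Ide C (ob Z n)"
    by metis
  have h: "f n \<cdot> \<iota> n n \<in> Hom C (U n) (ob Z n)" for n using comp_hom[OF F(6) f'(4)] .
  obtain g where g: "g \<in> Hom (ncomplexes N C) G Y" "\<And>n. g n \<cdot> \<iota> n n = s n \<cdot> (f n \<cdot> \<iota> n n)"
    using free_complex_extend[OF G P(1), of "\<lambda>n. s n \<cdot> (f n \<cdot> \<iota> n n)"] comp_hom[OF h s(1)] by blast
  have "p \<cdot>\<^bsub>ncomplexes N C\<^esub> g = f"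
  proof (rule free_complex_unique[OF G _ f])
    show "p \<cdot>\<^bsub>ncomplexes N C\<^esub> g \<in> Hom (ncomplexes N C) G Z"
      using category.comp_hom[OF preadditive_category.axioms(1)[OF ncomplexes_preadditive] g(1) p] .
    fix n
    have "(p n \<cdot> g n) \<cdot> \<iota> n n = p n \<cdot> (s n \<cdot> (f n \<cdot> \<iota> n n))"
      using comp_assoc[OF F(6) ncomplexes_homD(4)[OF g(1)] P(4)] g(2) by simp
    also have "\<dots> = f n \<cdot> \<iota> n n"
      using comp_assoc[OF h s(1) P(4)] s(2) comp_ide_left[OF h] by simp
    finally show "(p \<cdot>\<^bsub>ncomplexes N C\<^esub> g) n \<cdot> \<iota> n n = f n \<cdot> \<iota> n n" by simp
  qed
  then show "\<exists>g \<in> Hom (ncomplexes N C) G Y. p \<cdot>\<^bsub>ncomplexes N C\<^esub> g = f" using g(1) by blast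
qed

end

text \<open>
  The free complex on a single object \<open>T\<close> in degree \<open>n\<close> is the value at \<open>T\<close> of a left adjoint of
  the functor \<open>X \<mapsto> ob X n\<close>. This functor therefore preserves all pullbacks and kernels that happen to
  exist. The exactness axioms speak of arbitrary pullbacks and kernels of complexes, and this
  makes them accessible degree by degree.
\<close>

definition is_free_at ::
  "nat \<Rightarrow> ('o, 'm, 'e) preadditive_scheme \<Rightarrow> int \<Rightarrow> 'o \<Rightarrow> ('o, 'm) cplx \<Rightarrow> 'm \<Rightarrow> bool" where
  "is_free_at N C n T G \<iota> \<longleftrightarrow> is_ncomplex N C G \<and> \<iota> \<in> Hom C T (ob G n) \<and>
    (\<forall>X a. is_ncomplex N C X \<longrightarrow> a \<in> Hom C T (ob X n) \<longrightarrow>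
      (\<exists>\<phi> \<in> Hom (ncomplexes N C) G X. \<phi> n \<cdot>\<^bsub>C\<^esub> \<iota> = a)) \<and>
    (\<forall>X. \<forall>\<phi> \<in> Hom (ncomplexes N C) G X. \<forall>\<psi> \<in> Hom (ncomplexes N C) G X.
      \<phi> n \<cdot>\<^bsub>C\<^esub> \<iota> = \<psi> n \<cdot>\<^bsub>C\<^esub> \<iota> \<longrightarrow> \<phi> = \<psi>)"

lemma is_free_atD:
  assumes "is_free_at N C n T G \<iota>"
  shows "is_ncomplex N C G" "\<iota> \<in> Hom C T (ob G n)"
    "is_ncomplex N C X \<Longrightarrow> a \<in> Hom C T (ob X n) \<Longrightarrow>
      \<exists>\<phi> \<in> Hom (ncomplexes N C) G X. \<phi> n \<cdot>\<^bsub>C\<^esub> \<iota> = a"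
    "\<phi> \<in> Hom (ncomplexes N C) G X \<Longrightarrow> \<psi> \<in> Hom (ncomplexes N C) G X \<Longrightarrow>
      \<phi> n \<cdot>\<^bsub>C\<^esub> \<iota> = \<psi> n \<cdot>\<^bsub>C\<^esub> \<iota> \<Longrightarrow> \<phi> = \<psi>"
  using assms unfolding is_free_at_def by blast+

context additive_category
begin

lemma ex_free_complex:
  assumes U: "\<And>n. U n \<in> Obj C"
  shows "\<exists>G \<iota> \<pi>. is_free_complex N C U G \<iota> \<pi>"
proof -
  have "\<exists>D \<iota> \<pi>. is_family_biproduct C {m - int N<..m} U D \<iota> \<pi>" for m
    using ex_family_biproduct[of "{m - int N<..m}" U] U by simp
  then obtain D \<iota> \<pi> where b: "\<And>m. is_family_biproduct C {m - int N<..m} U (D m) (\<iota> m) (\<pi> m)"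
    by metis
  note B = family_biproductD[OF b] and K = coproductD[OF family_biproductD(6)[OF b]]
  have "\<exists>u. u \<in> Hom C (D m) (D (m + 1)) \<and> (\<forall>n \<in> {m - int N<..m}. u \<cdot> \<iota> m n = \<iota> (m + 1) n)" for m
    using coproductD(3)[OF family_biproductD(6)[OF b[of m]] K(1)[of "m + 1"], of "\<iota> (m + 1)"] B(2)
    by blast
  then obtain d where d: "\<And>m. d m \<in> Hom C (D m) (D (m + 1))"
    "\<And>m n. n \<in> {m - int N<..m} \<Longrightarrow> d m \<cdot> \<iota> m n = \<iota> (m + 1) n" by metis
  have "d m \<cdot> \<iota> m n = \<iota> (m + 1) n" if "n \<le> m" for m n
  proof (cases "m - int N < n")
    case True
    then show ?thesis using d(2) that by simp
  next
    case False
    then show ?thesis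
      using family_inclusion_zero[OF b, of n m] family_inclusion_zero[OF b, of n "m + 1"]
        comp_zero_right[OF d(1) U] by simp
  qed
  then have "is_free_complex N C U \<lparr>ob = D, diff = d\<rparr> \<iota> \<pi>"
    unfolding is_free_complex_def is_diagram_def using b d(1) K(1) by simp
  then show ?thesis by blast
qed

text \<open>
  The identities of the \<open>ob X n\<close> extend to a map of complexes that is degreewise split by the inclusion of the summand \<open>ob X n\<close> in degree \<open>n\<close>.
\<close>

lemma free_cover:
  assumes X: "is_ncomplex N C X"
  shows "\<exists>G \<iota> \<pi> p. is_free_complex N C (ob X) G \<iota> \<pi> \<and> adm_epi (levelwise_split N C) G p X"
proof -
  note obj = ncomplexD(2)[OF X]
  obtain G \<iota> \<pi> where G: "is_free_complex N C (ob X) G \<iota> \<pi>" using ex_free_complex[of "ob X", OF obj] by blast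
  obtain p where p: "p \<in> Hom (ncomplexes N C) G X" "\<And>n. p n \<cdot> \<iota> n n = Ide C (ob X n)"
    using free_complex_extend[OF G X, of "\<lambda>n. Ide C (ob X n)"] ide_hom[OF obj] by blast
  have "split_epi C (ob G m) (p m) (ob X m)" for m
  proof -
    obtain R \<rho> \<sigma> where "is_family_biproduct C ({m - int N<..m} - {m}) (ob X) R \<rho> \<sigma>"
      using ex_family_biproduct[of "{m - int N<..m} - {m}" "ob X"] obj by auto
    from split_epi_of_summand[OF free_complexD(3)[OF G] this ncomplexes_homD(4)[OF p(1)] p(2)]
    show ?thesis .
  qed
  then show ?thesis using G p(1) levelwise_adm_epi_iff by blast
qed

lemma ex_free_at:
  assumes T: "T \<in> Obj C"
  shows "\<exists>G \<iota>. is_free_at N C n T G \<iota>"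
proof -
  obtain W where zero: "zero_object C W" using ex_zero_object ..
  then have W: "W \<in> Obj C" "\<And>X. X \<in> Obj C \<Longrightarrow> \<exists>!f. f \<in> Hom C W X"
    by (simp_all add: zero_object_def)
  \<comment> \<open>The zero object in the other degrees leaves no choice for the values on the other generators.\<close>
  define U where "U m = (if m = n then T else W)" for m
  have "U m \<in> Obj C" for m using T W(1) by (simp add: U_def)
  then obtain G \<iota> \<pi> where G: "is_free_complex N C U G \<iota> \<pi>" using ex_free_complex by blast
  note F = free_complexD[OF G]
  have "\<exists>\<phi> \<in> Hom (ncomplexes N C) G X. \<phi> n \<cdot> \<iota> n n = a"
    if X: "is_ncomplex N C X" and a: "a \<in> Hom C T (ob X n)" for X a
  proof -
    have "(if m = n then a else Zero C W (ob X m)) \<in> Hom C (U m) (ob X m)" for m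
      using a zero_hom[OF W(1) ncomplexD(2)[OF X]] by (simp add: U_def)
    then obtain \<phi> where "\<phi> \<in> Hom (ncomplexes N C) G X"
      "\<forall>m. \<phi> m \<cdot> \<iota> m m = (if m = n then a else Zero C W (ob X m))"
      using free_complex_extend[OF G X, of "\<lambda>m. if m = n then a else Zero C W (ob X m)"] by blast
    then show ?thesis by (intro bexI[of _ \<phi>]) simp_all
  qed
  moreover have "\<phi> = \<psi>"
    if f: "\<phi> \<in> Hom (ncomplexes N C) G X" "\<psi> \<in> Hom (ncomplexes N C) G X"
      and eq: "\<phi> n \<cdot> \<iota> n n = \<psi> n \<cdot> \<iota> n n" for X \<phi> \<psi>
  proof (rule free_complex_unique[OF G f])
    fix m
    have h: "\<phi> m \<cdot> \<iota> m m \<in> Hom C (U m) (ob X m)" "\<psi> m \<cdot> \<iota> m m \<in> Hom C (U m) (ob X m)"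
      using comp_hom[OF F(6)] f[THEN ncomplexes_homD(4)] by blast+
    show "\<phi> m \<cdot> \<iota> m m = \<psi> m \<cdot> \<iota> m m"
      using h eq W(2)[OF hom_obj2[OF h(1)]] by (cases "m = n") (auto simp: U_def)
  qed
  moreover have "\<iota> n n \<in> Hom C T (ob G n)" using F(6)[of n n] by (simp add: U_def)
  ultimately show ?thesis using free_complex_is_ncomplex[OF G] unfolding is_free_at_def by blast
qed

lemma pullback_level:
  assumes pb: "is_pullback (ncomplexes N C) P p' f' Z' Y p f Z"
  shows "is_pullback C (ob P n) (p' n) (f' n) (ob Z' n) (ob Y n) (p n) (f n) (ob Z n)"
proof -
  interpret CN: preadditive_category "ncomplexes N C" by (rule ncomplexes_preadditive)
  note PB = CN.pullbackD[OF pb]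
  note h = PB(1-4)[THEN ncomplexes_homD(4)]
  show ?thesis
  proof (rule pullbackI[OF h])
    show "f n \<cdot> p' n = p n \<cdot> f' n" using PB(5) by (simp add: fun_eq_iff)
  next
    fix a b T assume ab: "a \<in> Hom C T (ob Z' n)" "b \<in> Hom C T (ob Y n)" "f n \<cdot> a = p n \<cdot> b"
    obtain G \<iota> where "is_free_at N C n T G \<iota>"
      using ex_free_at[OF hom_obj1[OF ab(1)]] by blast
    note G = is_free_atD[OF this]
    obtain \<alpha> where \<alpha>: "\<alpha> \<in> Hom (ncomplexes N C) G Z'" "\<alpha> n \<cdot> \<iota> = a"
      using G(3)[OF ncomplexes_homD(2)[OF PB(1)] ab(1)] by blast
    obtain \<beta> where \<beta>: "\<beta> \<in> Hom (ncomplexes N C) G Y" "\<beta> n \<cdot> \<iota> = b"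
      using G(3)[OF ncomplexes_homD(2)[OF PB(2)] ab(2)] by blast
    have "f \<cdot>\<^bsub>ncomplexes N C\<^esub> \<alpha> = p \<cdot>\<^bsub>ncomplexes N C\<^esub> \<beta>"
      by (rule G(4)[OF CN.comp_hom[OF \<alpha>(1) PB(4)] CN.comp_hom[OF \<beta>(1) PB(3)]])
        (use comp_assoc[OF G(2) ncomplexes_homD(4)[OF \<alpha>(1)] h(4)]
            comp_assoc[OF G(2) ncomplexes_homD(4)[OF \<beta>(1)] h(3)] \<alpha>(2) \<beta>(2) ab(3) in simp)
    then obtain u where u: "u \<in> Hom (ncomplexes N C) G P"
      "p' \<cdot>\<^bsub>ncomplexes N C\<^esub> u = \<alpha>" "f' \<cdot>\<^bsub>ncomplexes N C\<^esub> u = \<beta>"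
      using PB(6)[OF \<alpha>(1) \<beta>(1)] by blast
    note u' = ncomplexes_homD(4)[OF u(1)]
    have "p' n \<cdot> (u n \<cdot> \<iota>) = a" "f' n \<cdot> (u n \<cdot> \<iota>) = b"
      using comp_assoc[OF G(2) u' h(1)] comp_assoc[OF G(2) u' h(2)] u(2,3) \<alpha>(2) \<beta>(2) by auto
    then show "\<exists>u \<in> Hom C T (ob P n). p' n \<cdot> u = a \<and> f' n \<cdot> u = b"
      using comp_hom[OF G(2) u'] by blast
  next
    fix u v T assume uv: "u \<in> Hom C T (ob P n)" "v \<in> Hom C T (ob P n)"
      "p' n \<cdot> u = p' n \<cdot> v" "f' n \<cdot> u = f' n \<cdot> v"
    obtain G \<iota> where "is_free_at N C n T G \<iota>"
      using ex_free_at[OF hom_obj1[OF uv(1)]] by blast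
    note G = is_free_atD[OF this]
    obtain \<alpha> where \<alpha>: "\<alpha> \<in> Hom (ncomplexes N C) G P" "\<alpha> n \<cdot> \<iota> = u"
      using G(3)[OF ncomplexes_homD(1)[OF PB(1)] uv(1)] by blast
    obtain \<beta> where \<beta>: "\<beta> \<in> Hom (ncomplexes N C) G P" "\<beta> n \<cdot> \<iota> = v"
      using G(3)[OF ncomplexes_homD(1)[OF PB(1)] uv(2)] by blast
    note \<alpha>' = ncomplexes_homD(4)[OF \<alpha>(1)] and \<beta>' = ncomplexes_homD(4)[OF \<beta>(1)]
    have "p' \<cdot>\<^bsub>ncomplexes N C\<^esub> \<alpha> = p' \<cdot>\<^bsub>ncomplexes N C\<^esub> \<beta>"
      by (rule G(4)[OF CN.comp_hom[OF \<alpha>(1) PB(1)] CN.comp_hom[OF \<beta>(1) PB(1)]])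
        (use comp_assoc[OF G(2) \<alpha>' h(1)] comp_assoc[OF G(2) \<beta>' h(1)] \<alpha>(2) \<beta>(2) uv(3) in simp)
    moreover have "f' \<cdot>\<^bsub>ncomplexes N C\<^esub> \<alpha> = f' \<cdot>\<^bsub>ncomplexes N C\<^esub> \<beta>"
      by (rule G(4)[OF CN.comp_hom[OF \<alpha>(1) PB(2)] CN.comp_hom[OF \<beta>(1) PB(2)]])
        (use comp_assoc[OF G(2) \<alpha>' h(2)] comp_assoc[OF G(2) \<beta>' h(2)] \<alpha>(2) \<beta>(2) uv(4) in simp)
    ultimately have "\<alpha> = \<beta>" using PB(7)[OF \<alpha>(1) \<beta>(1)] by blast
    then show "u = v" using \<alpha>(2) \<beta>(2) by simp
  qed
qed

lemma kernel_level:
  assumes k: "is_kernel (ncomplexes N C) X i Y p Z"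
  shows "is_kernel C (ob X n) (i n) (ob Y n) (p n) (ob Z n)"
proof -
  interpret CN: preadditive_category "ncomplexes N C" by (rule ncomplexes_preadditive)
  note K = CN.kernelD[OF k]
  note h = K(1,2)[THEN ncomplexes_homD(4)]
  show ?thesis
  proof (rule kernelI[OF h])
    show "p n \<cdot> i n = Zero C (ob X n) (ob Z n)" using K(3) by (simp add: fun_eq_iff)
  next
    fix t T assume t: "t \<in> Hom C T (ob Y n)" "p n \<cdot> t = Zero C T (ob Z n)"
    obtain G \<iota> where "is_free_at N C n T G \<iota>"
      using ex_free_at[OF hom_obj1[OF t(1)]] by blast
    note G = is_free_atD[OF this]
    obtain \<tau> where \<tau>: "\<tau> \<in> Hom (ncomplexes N C) G Y" "\<tau> n \<cdot> \<iota> = t"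
      using G(3)[OF ncomplexes_homD(2)[OF K(1)] t(1)] by blast
    note Z = ncomplexes_homD(2)[OF K(2)]
    have zero: "Zero (ncomplexes N C) G Z \<in> Hom (ncomplexes N C) G Z"
      using CN.zero_hom G(1) Z by simp
    have "p \<cdot>\<^bsub>ncomplexes N C\<^esub> \<tau> = Zero (ncomplexes N C) G Z"
      by (rule G(4)[OF CN.comp_hom[OF \<tau>(1) K(2)] zero])
        (use comp_assoc[OF G(2) ncomplexes_homD(4)[OF \<tau>(1)] h(2)] \<tau>(2) t(2)
          comp_zero_left[OF G(2) ncomplexD(2)[OF Z]] in simp)
    then obtain u where u: "u \<in> Hom (ncomplexes N C) G X" "i \<cdot>\<^bsub>ncomplexes N C\<^esub> u = \<tau>"
      using K(4)[OF \<tau>(1)] by blast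
    note u' = ncomplexes_homD(4)[OF u(1)]
    have "i n \<cdot> (u n \<cdot> \<iota>) = t" using comp_assoc[OF G(2) u' h(1)] u(2) \<tau>(2) by auto
    then show "\<exists>u \<in> Hom C T (ob X n). i n \<cdot> u = t" using comp_hom[OF G(2) u'] by blast
  next
    fix u v T assume uv: "u \<in> Hom C T (ob X n)" "v \<in> Hom C T (ob X n)" "i n \<cdot> u = i n \<cdot> v"
    obtain G \<iota> where "is_free_at N C n T G \<iota>"
      using ex_free_at[OF hom_obj1[OF uv(1)]] by blast
    note G = is_free_atD[OF this]
    obtain \<alpha> where \<alpha>: "\<alpha> \<in> Hom (ncomplexes N C) G X" "\<alpha> n \<cdot> \<iota> = u"
      using G(3)[OF ncomplexes_homD(1)[OF K(1)] uv(1)] by blast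
    obtain \<beta> where \<beta>: "\<beta> \<in> Hom (ncomplexes N C) G X" "\<beta> n \<cdot> \<iota> = v"
      using G(3)[OF ncomplexes_homD(1)[OF K(1)] uv(2)] by blast
    note \<alpha>' = ncomplexes_homD(4)[OF \<alpha>(1)] and \<beta>' = ncomplexes_homD(4)[OF \<beta>(1)]
    have "i \<cdot>\<^bsub>ncomplexes N C\<^esub> \<alpha> = i \<cdot>\<^bsub>ncomplexes N C\<^esub> \<beta>"
      by (rule G(4)[OF CN.comp_hom[OF \<alpha>(1) K(1)] CN.comp_hom[OF \<beta>(1) K(1)]])
        (use comp_assoc[OF G(2) \<alpha>' h(1)] comp_assoc[OF G(2) \<beta>' h(1)] \<alpha>(2) \<beta>(2) uv(3) in simp)
    then have "\<alpha> = \<beta>" using K(5)[OF \<alpha>(1) \<beta>(1)] by blast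
    then show "u = v" using \<alpha>(2) \<beta>(2) by simp
  qed
qed

end


section \<open>Duality for N-complexes\<close>

text \<open>
  The differential from degree \<open>- n - 1\<close> to degree \<open>- n\<close> is, in the opposite category, a map from the
  object in degree \<open>- n\<close> to that in degree \<open>- (n + 1)\<close>.
\<close>

definition dual_cplx :: "('o, 'm) cplx \<Rightarrow> ('o, 'm) cplx" where
  "dual_cplx X = \<lparr>ob = \<lambda>n. ob X (- n), diff = \<lambda>n. diff X (- n - 1)\<rparr>"

definition dual_map :: "(int \<Rightarrow> 'm) \<Rightarrow> int \<Rightarrow> 'm" where
  "dual_map f n = f (- n)"

lemma dual_cplx_simps [simp]:
  "ob (dual_cplx X) n = ob X (- n)" "diff (dual_cplx X) n = diff X (- n - 1)"
  by (simp_all add: dual_cplx_def)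

lemma dual_involution [simp]: "dual_cplx (dual_cplx X) = X" "dual_map (dual_map f) = f"
  by (simp_all add: dual_cplx_def dual_map_def fun_eq_iff)

lemma dual_map_eq_iff [simp]: "dual_map f = dual_map g \<longleftrightarrow> f = g"
  by (metis dual_involution(2))

lemma all_dual_map:
  "(\<forall>X f Y. P X f Y) \<longleftrightarrow> (\<forall>Y f X. P (dual_cplx X) (dual_map f) (dual_cplx Y))"
  by (metis dual_involution)

lemma opposite_opposite:
  "is_diagram (opposite (opposite C)) X = is_diagram C X"
  "is_diagram_map (opposite (opposite C)) X Y f = is_diagram_map C X Y f"
  "is_ncomplex N (opposite (opposite C)) X = is_ncomplex N C X"
  "is_biproduct (opposite (opposite C)) A B D i j p q = is_biproduct C A B D i j p q"
proof -
  have "diff_pow (opposite (opposite C)) X k n = diff_pow C X k n" for k n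
    by (induction k) simp_all
  then show "is_ncomplex N (opposite (opposite C)) X = is_ncomplex N C X"
    by (simp add: is_ncomplex_def)
qed (simp_all add: is_diagram_def is_diagram_map_def is_biproduct_def)

lemma dual_diagram: "is_diagram C X \<Longrightarrow> is_diagram (opposite C) (dual_cplx X)"
proof -
  assume X: "is_diagram C X"
  have "diff X (- n - 1) \<in> Hom C (ob X (- n - 1)) (ob X (- n - 1 + 1))" for n
    using X unfolding is_diagram_def by blast
  then show ?thesis using X by (simp add: is_diagram_def)
qed

lemma dual_diagram_map:
  "is_diagram_map C X Y f \<Longrightarrow> is_diagram_map (opposite C) (dual_cplx Y) (dual_cplx X) (dual_map f)"
proof -
  assume f: "is_diagram_map C X Y f"
  have "f (- n - 1 + 1) \<cdot>\<^bsub>C\<^esub> diff X (- n - 1) = diff Y (- n - 1) \<cdot>\<^bsub>C\<^esub> f (- n - 1)" for n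
    using f unfolding is_diagram_map_def by blast
  then show ?thesis using f by (simp add: is_diagram_map_def dual_map_def)
qed

lemma dual_comp:
  "Comp (ncomplexes N (opposite C)) (dual_map g) (dual_map f) = dual_map (Comp (ncomplexes N C) f g)"
  by (simp add: fun_eq_iff dual_map_def)

lemma dual_zero:
  "Zero (ncomplexes N (opposite C)) (dual_cplx X) (dual_cplx Y) = dual_map (Zero (ncomplexes N C) Y X)"
  by (simp add: fun_eq_iff dual_map_def)

context preadditive_category
begin

lemma dual_diff_pow:
  assumes X: "is_diagram C X"
  shows "diff_pow (opposite C) (dual_cplx X) k n = diff_pow C X k (- n - int k)"
proof (induction k)
  case 0
  show ?case by simp
next
  case (Suc k)
  have "diff_pow (opposite C) (dual_cplx X) (Suc k) n =
      diff_pow C X k (- n - int k - 1 + 1) \<cdot> diff X (- n - int k - 1)"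
    using Suc by (simp add: algebra_simps)
  also have "\<dots> = diff_pow C X (Suc k) (- n - int k - 1)"
    by (rule diff_pow_Suc_right[OF X, symmetric])
  finally show ?case by (simp add: algebra_simps)
qed

lemma dual_ncomplex:
  assumes X: "is_ncomplex N C X"
  shows "is_ncomplex N (opposite C) (dual_cplx X)"
proof -
  have "diff_pow C X N (- n - int N) = Zero C (ob X (- n - int N)) (ob X (- n - int N + int N))" for n
    by (rule ncomplexD(4)[OF X])
  then show ?thesis
    using dual_diagram[OF ncomplexD(1)[OF X]] dual_diff_pow[OF ncomplexD(1)[OF X]]
    by (simp add: is_ncomplex_iff)
qed

lemma dual_ncomplex_iff: "is_ncomplex N (opposite C) (dual_cplx X) \<longleftrightarrow> is_ncomplex N C X"
  using dual_ncomplex preadditive_category.dual_ncomplex[OF opposite_preadditive, of N "dual_cplx X"]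
  by (auto simp: opposite_opposite)

lemma dual_hom_iff:
  "dual_map f \<in> Hom (ncomplexes N (opposite C)) (dual_cplx Y) (dual_cplx X) \<longleftrightarrow>
    f \<in> Hom (ncomplexes N C) X Y"
  using dual_diagram_map[of C X Y f] dual_diagram_map[of "opposite C" "dual_cplx Y" "dual_cplx X" "dual_map f"]
  by (auto simp: ncomplexes_hom_iff dual_ncomplex_iff opposite_opposite)

text \<open>
  The bijections \<open>dual_cplx\<close> and \<open>dual_map\<close> form a contravariant isomorphism from the category of
  complexes in \<open>C\<close> to that of complexes in the opposite of \<open>C\<close>. The next lemmas move the
  quantifiers of the categorical notions along it.
\<close>

lemma ball_dual_obj:
  "(\<forall>T \<in> Obj (ncomplexes N (opposite C)). P T) \<longleftrightarrow> (\<forall>T \<in> Obj (ncomplexes N C). P (dual_cplx T))"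
  using dual_ncomplex_iff by simp (metis dual_involution(1))

lemma ball_dual_hom:
  "(\<forall>f \<in> Hom (ncomplexes N (opposite C)) (dual_cplx Y) (dual_cplx X). P f) \<longleftrightarrow>
    (\<forall>f \<in> Hom (ncomplexes N C) X Y. P (dual_map f))"
  using dual_hom_iff by (metis dual_involution(2))

lemma bex_dual_hom:
  "(\<exists>f \<in> Hom (ncomplexes N (opposite C)) (dual_cplx Y) (dual_cplx X). P f) \<longleftrightarrow>
    (\<exists>f \<in> Hom (ncomplexes N C) X Y. P (dual_map f))"
  using dual_hom_iff by (metis dual_involution(2))

lemma ex1_dual_hom:
  "(\<exists>!f. f \<in> Hom (ncomplexes N (opposite C)) (dual_cplx Y) (dual_cplx X) \<and> P f) \<longleftrightarrow>
    (\<exists>!f. f \<in> Hom (ncomplexes N C) X Y \<and> P (dual_map f))"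
proof -
  have "(\<exists>!f. Q f) \<longleftrightarrow> (\<exists>!f. Q (dual_map f))" for Q :: "(int \<Rightarrow> 'm) \<Rightarrow> bool"
    by (metis dual_involution(2))
  from this[of "\<lambda>f. f \<in> Hom (ncomplexes N (opposite C)) (dual_cplx Y) (dual_cplx X) \<and> P f"]
  show ?thesis by (simp only: dual_hom_iff)
qed

lemmas dual_transfer = dual_hom_iff ball_dual_obj ball_dual_hom bex_dual_hom ex1_dual_hom
  dual_comp dual_zero dual_map_eq_iff

lemma dual_pullback_iff:
  "is_pullback (ncomplexes N (opposite C)) (dual_cplx P) (dual_map i') (dual_map f') (dual_cplx X')
      (dual_cplx Y) (dual_map i) (dual_map f) (dual_cplx X) \<longleftrightarrow>
    is_pushout (ncomplexes N C) X i f X' Y i' f' P"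
  unfolding is_pullback_def is_pushout_def dual_transfer by blast

lemma dual_kernel_iff:
  "is_kernel (ncomplexes N (opposite C)) (dual_cplx Q) (dual_map q) (dual_cplx Y) (dual_map i) (dual_cplx X)
    \<longleftrightarrow> is_cokernel (ncomplexes N C) X i Y q Q"
  unfolding is_kernel_def is_cokernel_def dual_transfer by blast

lemma dual_levelwise_split:
  assumes "(X, f, Y, g, Z) \<in> levelwise_split N C"
  shows "(dual_cplx Z, dual_map g, dual_cplx Y, dual_map f, dual_cplx X)
    \<in> levelwise_split N (opposite C)"
proof -
  have "\<exists>s r. is_biproduct (opposite C) (ob Z n) (ob X n) (ob Y n) (g n) s r (f n)" for n
    using assms opposite_biproduct unfolding levelwise_split_iff by metis
  then show ?thesis
    using assms unfolding levelwise_split_iff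
      preadditive_category.levelwise_split_iff[OF opposite_preadditive]
    by (simp add: dual_hom_iff) (simp add: dual_map_def)
qed

lemma dual_levelwise_split_iff:
  "(dual_cplx Z, dual_map g, dual_cplx Y, dual_map f, dual_cplx X) \<in> levelwise_split N (opposite C)
    \<longleftrightarrow> (X, f, Y, g, Z) \<in> levelwise_split N C"
proof
  assume "(dual_cplx Z, dual_map g, dual_cplx Y, dual_map f, dual_cplx X)
    \<in> levelwise_split N (opposite C)"
  from preadditive_category.dual_levelwise_split[OF opposite_preadditive this]
  have "(X, f, Y, g, Z) \<in> levelwise_split N (opposite (opposite C))" by simp
  then show "(X, f, Y, g, Z) \<in> levelwise_split N C"
    unfolding levelwise_split_iff preadditive_category.levelwise_split_iff[OF
        preadditive_category.opposite_preadditive[OF opposite_preadditive]]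
    by (simp add: ncomplexes_hom_iff opposite_opposite)
qed (rule dual_levelwise_split)

lemma dual_adm_epi_iff:
  "adm_epi (levelwise_split N (opposite C)) (dual_cplx Y) (dual_map i) (dual_cplx X) \<longleftrightarrow>
    adm_mono (levelwise_split N C) X i Y"
  unfolding adm_epi_def adm_mono_def
  using dual_levelwise_split_iff by (metis dual_involution)

lemma dual_adm_mono_iff:
  "adm_mono (levelwise_split N (opposite C)) (dual_cplx Z) (dual_map p) (dual_cplx Y) \<longleftrightarrow>
    adm_epi (levelwise_split N C) Y p Z"
  unfolding adm_epi_def adm_mono_def
  using dual_levelwise_split_iff by (metis dual_involution)

lemma dual_projective_iff:
  "rel_projective (ncomplexes N (opposite C)) (levelwise_split N (opposite C)) (dual_cplx X) \<longleftrightarrow>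
    rel_injective (ncomplexes N C) (levelwise_split N C) X"
  unfolding rel_projective_def rel_injective_def
  by (subst all_dual_map) (simp only: dual_transfer dual_adm_epi_iff ncomplexes_simps(1)
    mem_Collect_eq dual_ncomplex_iff)

lemma dual_injective_iff:
  "rel_injective (ncomplexes N (opposite C)) (levelwise_split N (opposite C)) (dual_cplx X) \<longleftrightarrow>
    rel_projective (ncomplexes N C) (levelwise_split N C) X"
  unfolding rel_projective_def rel_injective_def
  by (subst all_dual_map) (simp only: dual_transfer dual_adm_mono_iff ncomplexes_simps(1)
    mem_Collect_eq dual_ncomplex_iff)

lemma family_biproduct_reindex:
  assumes b: "is_family_biproduct C J V D \<iota> \<pi>" and h: "\<And>n. h (h n) = n"
  shows "is_family_biproduct C (h -` J) (\<lambda>n. V (h n)) D (\<lambda>n. \<iota> (h n)) (\<lambda>n. \<pi> (h n))"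
proof -
  have co: "is_coproduct B (h -` J) (\<lambda>n. V (h n)) D (\<lambda>n. j (h n))" if c: "is_coproduct B J V D j"
    for B :: "('o, 'm, 'x) preadditive_scheme" and j
    unfolding is_coproduct_def
  proof (intro conjI ballI allI impI)
    show "D \<in> Obj B" "\<And>n. n \<in> h -` J \<Longrightarrow> j (h n) \<in> Hom B (V (h n)) D"
      using c by (auto simp: is_coproduct_def)
    fix T g assume T: "T \<in> Obj B" and g: "\<forall>n \<in> h -` J. g n \<in> Hom B (V (h n)) T"
    have all: "(\<forall>n \<in> h -` J. P n) \<longleftrightarrow> (\<forall>n \<in> J. P (h n))" for P using h by (metis vimage_eq)
    show "\<exists>!u. u \<in> Hom B D T \<and> (\<forall>n \<in> h -` J. u \<cdot>\<^bsub>B\<^esub> j (h n) = g n)"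
      using c T g unfolding is_coproduct_def all h by (elim conjE ballE[of _ _ T] allE[of _ "\<lambda>n. g (h n)"]) auto
  qed
  have "h m = h n \<longleftrightarrow> m = n" for m n using h by metis
  then show ?thesis using b unfolding is_family_biproduct_def by (simp add: co)
qed

text \<open>
  A finite string \<open>U \<rightarrow> U \<rightarrow> \<dots> \<rightarrow> U\<close> of identities is also cofree on its last term, so that the dual of a
  free complex is free. The string of \<open>U q\<close> ends in degree \<open>q + N - 1\<close>, which under negation of the
  degrees is where the dual string begins.
\<close>

lemma dual_free_complex:
  assumes G: "is_free_complex N C U G \<iota> \<pi>"
  shows "is_free_complex N (opposite C) (\<lambda>n. U (1 - int N - n)) (dual_cplx G)
    (\<lambda>m n. \<pi> (- m) (1 - int N - n)) (\<lambda>m n. \<iota> (- m) (1 - int N - n))"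
proof -
  note F = free_complexD[OF G]
  \<comment> \<open>The hypothesis on \<open>q\<close> says that the string of \<open>U q\<close> does not end before degree \<open>k + 1\<close>.\<close>
  have step: "\<pi> (k + 1) q \<cdot> diff G k = \<pi> k q" if q: "k + 1 - int N < q" for k q
  proof (rule family_jointly_epic[OF F(3) comp_hom[OF F(2,7)] F(7)])
    fix n assume n: "n \<in> {k - int N<..k}"
    have "(\<pi> (k + 1) q \<cdot> diff G k) \<cdot> \<iota> k n = \<pi> (k + 1) q \<cdot> \<iota> (k + 1) n"
      using comp_assoc[OF F(6,2,7)] F(4)[of n k] n by simp
    also have "\<dots> = \<pi> k q \<cdot> \<iota> k n"
    proof (cases "q = n")
      case True
      then show ?thesis
        using family_biproductD(4)[OF F(3), of n k] family_biproductD(4)[OF F(3), of n "k + 1"] n q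
        by simp
    next
      case False
      then show ?thesis
        using family_biproductD(5)[OF F(3), of n k q] family_biproductD(5)[OF F(3), of n "k + 1" q]
        by simp
    qed
    finally show "(\<pi> (k + 1) q \<cdot> diff G k) \<cdot> \<iota> k n = \<pi> k q \<cdot> \<iota> k n" .
  qed
  have "is_family_biproduct (opposite C) {m - int N<..m} (\<lambda>n. U (1 - int N - n)) (ob G (- m))
    (\<lambda>n. \<pi> (- m) (1 - int N - n)) (\<lambda>n. \<iota> (- m) (1 - int N - n))" for m
  proof -
    have "(\<lambda>n. 1 - int N - n) -` {- m - int N<..- m} = {m - int N<..m}" by auto
    then show ?thesis
      using opposite_family_biproduct[OF family_biproduct_reindex[OF F(3), of "\<lambda>n. 1 - int N - n" "- m"]]
      by simp
  qed
  moreover have "\<pi> (- m) (1 - int N - n) \<cdot> diff G (- m - 1) = \<pi> (- m - 1) (1 - int N - n)"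
    if "n \<le> m" for m n
    using step[of "- m - 1" "1 - int N - n"] that by simp
  ultimately show ?thesis
    unfolding is_free_complex_def using dual_diagram[OF F(1)] by simp
qed

lemma free_complex_injective:
  assumes G: "is_free_complex N C U G \<iota> \<pi>"
  shows "rel_injective (ncomplexes N C) (levelwise_split N C) G"
  using preadditive_category.free_complex_projective[OF opposite_preadditive dual_free_complex[OF G]]
  by (simp add: dual_projective_iff)

end


section \<open>The Frobenius exact structure\<close>

context additive_category
begin

lemma levelwise_epi_comp:
  assumes "adm_epi (levelwise_split N C) X p Y" "adm_epi (levelwise_split N C) Y q Z"
  shows "adm_epi (levelwise_split N C) X (q \<cdot>\<^bsub>ncomplexes N C\<^esub> p) Z"
proof -
  interpret CN: preadditive_category "ncomplexes N C" by (rule ncomplexes_preadditive)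
  show ?thesis
    using assms CN.comp_hom[of p X Y q Z] by (auto simp: levelwise_adm_epi_iff intro: split_epi_comp)
qed

lemma levelwise_ex_pullback:
  assumes "adm_epi (levelwise_split N C) Y p Z" "f \<in> Hom (ncomplexes N C) Z' Z"
  shows "\<exists>P p' f'. is_pullback (ncomplexes N C) P p' f' Z' Y p f Z"
  using assms ex_pullback_split_epi ncomplexes_homD(4) unfolding levelwise_adm_epi_iff
  by (intro levelwise_pullback) blast+

lemma levelwise_epi_pullback:
  assumes "adm_epi (levelwise_split N C) Y p Z" "is_pullback (ncomplexes N C) P p' f' Z' Y p f Z"
  shows "adm_epi (levelwise_split N C) P p' Z'"
  using assms pullback_split_epi[OF pullback_level[OF assms(2)]] unfolding levelwise_adm_epi_iff
  by (simp add: is_pullback_def)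

text \<open>
  A section of \<open>p e\<close> composed with \<open>e\<close> is a section of \<open>p\<close>, and the kernel of \<open>p\<close> in the category of
  complexes is a kernel in every degree.
\<close>

lemma levelwise_epi_cancel:
  assumes k: "is_kernel (ncomplexes N C) K k Y p Z" and e: "e \<in> Hom (ncomplexes N C) W Y"
    and pe: "adm_epi (levelwise_split N C) W (p \<cdot>\<^bsub>ncomplexes N C\<^esub> e) Z"
  shows "adm_epi (levelwise_split N C) Y p Z"
proof -
  have p: "p \<in> Hom (ncomplexes N C) Y Z" using k by (simp add: is_kernel_def)
  have "split_epi C (ob Y n) (p n) (ob Z n)" for n
  proof -
    have "split_epi C (ob W n) (p n \<cdot> e n) (ob Z n)" using pe by (simp add: levelwise_adm_epi_iff)
    then obtain s where s: "s \<in> Hom C (ob Z n) (ob W n)" "(p n \<cdot> e n) \<cdot> s = Ide C (ob Z n)"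
      by (rule split_epiE)
    show ?thesis
    proof (rule split_epiI[OF kernel_level[OF k]])
      show "e n \<cdot> s \<in> Hom C (ob Z n) (ob Y n)" using comp_hom[OF s(1) ncomplexes_homD(4)[OF e]] .
      show "p n \<cdot> (e n \<cdot> s) = Ide C (ob Z n)"
        using comp_assoc[OF s(1) ncomplexes_homD(4)[OF e] ncomplexes_homD(4)[OF p]] s(2) by simp
    qed
  qed
  then show ?thesis using p by (simp add: levelwise_adm_epi_iff)
qed

lemma ex_projective_cover:
  assumes "X \<in> Obj (ncomplexes N C)"
  shows "\<exists>P p. rel_projective (ncomplexes N C) (levelwise_split N C) P \<and>
    adm_epi (levelwise_split N C) P p X"
  using free_cover[of N X] assms free_complex_projective by simp blast

text \<open>
  A projective complex is a retract of a free complex that covers it, and retracts of injective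
  objects are injective.
\<close>

lemma projective_imp_injective:
  assumes P: "rel_projective (ncomplexes N C) (levelwise_split N C) P"
  shows "rel_injective (ncomplexes N C) (levelwise_split N C) P"
proof -
  interpret CN: preadditive_category "ncomplexes N C" by (rule ncomplexes_preadditive)
  have PO: "P \<in> Obj (ncomplexes N C)" using P by (simp add: rel_projective_def)
  then have "is_ncomplex N C P" by simp
  then obtain G \<iota> \<pi> p where G: "is_free_complex N C (ob P) G \<iota> \<pi>"
    and p: "adm_epi (levelwise_split N C) G p P"
    using free_cover by blast
  have p': "p \<in> Hom (ncomplexes N C) G P" using p by (simp add: levelwise_adm_epi_iff)
  obtain s where s: "s \<in> Hom (ncomplexes N C) P G" "p \<cdot>\<^bsub>ncomplexes N C\<^esub> s = Ide (ncomplexes N C) P"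
    using P p CN.ide_hom[OF PO] unfolding rel_projective_def by blast
  have "\<exists>g \<in> Hom (ncomplexes N C) Y P. g \<cdot>\<^bsub>ncomplexes N C\<^esub> i = f"
    if i: "adm_mono (levelwise_split N C) X i Y" and f: "f \<in> Hom (ncomplexes N C) X P" for X i Y f
  proof -
    obtain g where g: "g \<in> Hom (ncomplexes N C) Y G"
      "g \<cdot>\<^bsub>ncomplexes N C\<^esub> i = s \<cdot>\<^bsub>ncomplexes N C\<^esub> f"
      using free_complex_injective[OF G] i CN.comp_hom[OF f s(1)] unfolding rel_injective_def by blast
    have i': "i \<in> Hom (ncomplexes N C) X Y" using i unfolding adm_mono_def levelwise_split_iff by blast
    have "(p \<cdot>\<^bsub>ncomplexes N C\<^esub> g) \<cdot>\<^bsub>ncomplexes N C\<^esub> i = f"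
      using CN.comp_assoc[OF i' g(1) p'] CN.comp_assoc[OF f s(1) p'] g(2) s(2) CN.comp_ide_left[OF f]
      by metis
    then show ?thesis using CN.comp_hom[OF g(1) p'] by blast
  qed
  then show ?thesis unfolding rel_injective_def using PO by blast
qed

end

theorem theorem5p8:
  fixes A :: "('o, 'm) preadditive" and N :: nat
  assumes "additive_category A"
  shows "frobenius_exact_structure (ncomplexes N A) (levelwise_split N A)"
proof -
  interpret A: additive_category A by (rule assms)
  interpret B: additive_category "opposite A" by (rule A.opposite_additive)
  let ?C = "ncomplexes N A" and ?S = "levelwise_split N A"
  note epi = A.dual_adm_epi_iff[symmetric]
  show ?thesis
  proof (intro frobenius_exact_structure.intro exact_structure.intro A.ncomplexes_additive
      exact_structure_axioms.intro frobenius_exact_structure_axioms.intro)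
    show "s \<in> ?S \<Longrightarrow> isomorphic_seqs ?C s t \<Longrightarrow> t \<in> ?S" for s t
      by (rule A.levelwise_split_isomorphic)
    show "is_biproduct ?C X Y D i j p q \<Longrightarrow> (X, i, D, q, Y) \<in> ?S" for X Y D i j p q
      by (rule A.levelwise_split_biproduct)
    show "(X, i, Y, p, Z) \<in> ?S \<Longrightarrow> is_kernel ?C X i Y p Z" for X i Y p Z
      by (rule A.levelwise_split_kernel)
    show "(X, i, Y, p, Z) \<in> ?S \<Longrightarrow> is_cokernel ?C X i Y p Z" for X i Y p Z
      using B.levelwise_split_kernel A.dual_levelwise_split_iff A.dual_kernel_iff by blast
    show "adm_epi ?S X p Y \<Longrightarrow> adm_epi ?S Y q Z \<Longrightarrow> adm_epi ?S X (q \<cdot>\<^bsub>?C\<^esub> p) Z" for X p Y q Z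
      by (rule A.levelwise_epi_comp)
    show "adm_mono ?S X i Y \<Longrightarrow> adm_mono ?S Y j Z \<Longrightarrow> adm_mono ?S X (j \<cdot>\<^bsub>?C\<^esub> i) Z" for X i Y j Z
      unfolding epi using B.levelwise_epi_comp dual_comp by metis
    show "adm_epi ?S Y p Z \<Longrightarrow> f \<in> Hom ?C Z' Z \<Longrightarrow> \<exists>P p' f'. is_pullback ?C P p' f' Z' Y p f Z"
      for Y p Z f Z'
      by (rule A.levelwise_ex_pullback)
    show "adm_epi ?S Y p Z \<Longrightarrow> is_pullback ?C P p' f' Z' Y p f Z \<Longrightarrow> adm_epi ?S P p' Z'"
      for Y p Z P p' f' Z' f
      by (rule A.levelwise_epi_pullback)
    show "\<exists>P i' f'. is_pushout ?C X i f X' Y i' f' P"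
      if i: "adm_mono ?S X i Y" and f: "f \<in> Hom ?C X X'" for X i Y f X'
    proof -
      obtain P i' f' where "is_pullback (ncomplexes N (opposite A)) P i' f' (dual_cplx X')
          (dual_cplx Y) (dual_map i) (dual_map f) (dual_cplx X)"
        using B.levelwise_ex_pullback[OF i[unfolded epi]] f A.dual_hom_iff by blast
      then have "is_pushout ?C X i f X' Y (dual_map i') (dual_map f') (dual_cplx P)"
        using A.dual_pullback_iff[of N "dual_cplx P" "dual_map i'" "dual_map f'"] by simp
      then show ?thesis by blast
    qed
    show "adm_mono ?S X i Y \<Longrightarrow> is_pushout ?C X i f X' Y i' f' P \<Longrightarrow> adm_mono ?S X' i' P"
      for X i Y f X' i' f' P
      unfolding epi A.dual_pullback_iff[symmetric] by (rule B.levelwise_epi_pullback)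
    show "is_kernel ?C K k Y p Z \<Longrightarrow> e \<in> Hom ?C W Y \<Longrightarrow> adm_epi ?S W (p \<cdot>\<^bsub>?C\<^esub> e) Z \<Longrightarrow> adm_epi ?S Y p Z"
      for K k Y p Z e W
      by (rule A.levelwise_epi_cancel)
    show "is_cokernel ?C X i Y q Q \<Longrightarrow> m \<in> Hom ?C Y W \<Longrightarrow> adm_mono ?S X (m \<cdot>\<^bsub>?C\<^esub> i) W \<Longrightarrow> adm_mono ?S X i Y"
      for X i Y q Q m W
      unfolding epi A.dual_kernel_iff[symmetric] A.dual_hom_iff[symmetric] dual_comp[symmetric]
      by (rule B.levelwise_epi_cancel)
    show "X \<in> Obj ?C \<Longrightarrow> \<exists>P p. rel_projective ?C ?S P \<and> adm_epi ?S P p X" for X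
      by (rule A.ex_projective_cover)
    show "\<exists>I i. rel_injective ?C ?S I \<and> adm_mono ?S X i I" if "X \<in> Obj ?C" for X
    proof -
      have "dual_cplx X \<in> Obj (ncomplexes N (opposite A))" using that A.dual_ncomplex by simp
      then obtain P p where "rel_projective (ncomplexes N (opposite A)) (levelwise_split N (opposite A)) P"
        "adm_epi (levelwise_split N (opposite A)) P p (dual_cplx X)"
        using B.ex_projective_cover by blast
      then have "rel_injective ?C ?S (dual_cplx P)" "adm_mono ?S X (dual_map p) (dual_cplx P)"
        using A.dual_projective_iff[of N "dual_cplx P"] A.dual_adm_epi_iff[of N "dual_cplx P" "dual_map p"]
        by simp_all
      then show ?thesis by blast
    qed
    show "rel_projective ?C ?S X = rel_injective ?C ?S X" for X
      using A.projective_imp_injective[of N X] B.projective_imp_injective[of N "dual_cplx X"]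
      unfolding A.dual_projective_iff A.dual_injective_iff by blast
  qed
qed

end
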